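(* Let $G$ be an infinite, connected, vertex-transitive, $d$-regular directed graph (with symmetric edge set). Suppose $\tilde\chi(G,{\bf p})<\infty$. Then there exists $\tilde\alpha(G,{\bf p})>0$ such that $$P_{\bf p}(o\leftrightarrow\partial B(n))\le 2e^{-n\tilde\alpha(G,{\bf p})}$$ for any sufficiently large $n$.
   Context: $G=(V,E,o)$ is an infinite simple directed graph with origin $o\in V$: $V$ is countably infinite, $E\subset V\times V\setminus\{(x,x)\}$, and $(x,y)\in E$ iff $(y,x)\in E$; $x\sim y$ means $(x,y)\in E$; $L_x=\{y:(x,y)\in E\}$. $G$ is $d$-regular ($|L_x|=d$ for all $x$), connected with respect to $\sim$, and vertex-transitive (automorphisms act transitively on $V$). $\partial B(n)$ is the set of vertices at graph distance exactly $n$ from $o$. Let ${\bf p}=(p_0,\dots,p_d)$ with $p_i\ge0$ and $\sum_i p_i=1$. Configurations are $\omega\in\Omega=\prod_{x\in V}2^{L_x}$ with the $\sigma$-field generated by finite-dimensional cylinders; $P_{\bf p}$ is the product measure under which the states $\omega(x)\subset L_x$ are independent with $P_{\bf p}(\omega(x)=S)=p_{|S|}/\binom{d}{|S|}$ for $S\subset L_x$. Put $E_\omega=\{(x,y):x\in V,\ y\in\omega(x)\}$. Vertices $x,y$ are strongly connected ($x\leftrightarrow y$) if $x=y$ or there are $x=z_0,\dots,z_m=y$ such that for each $i$, both $(z_i,z_{i+1})\in E_\omega$ and $(z_{i+1},z_i)\in E_\omega$; $o\leftrightarrow\partial B(n)$ means $o\leftrightarrow x$ for some $x\in\partial B(n)$.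 $|\tilde C|$ is the number of vertices strongly connected to $o$, and $\tilde\chi(G,{\bf p})=\mathbb{E}_{\bf p}(|\tilde C|)$. *)

theory Defs
  imports "HOL-Probability.Probability" "Graph_Theory.Graph_Theory"
begin

section \<open>Regular and vertex-transitive digraphs\<close>

definition out_nbrs :: "'a pair_pre_digraph \<Rightarrow> 'a \<Rightarrow> 'a set" where
  "out_nbrs G x = {y. (x, y) \<in> parcs G}"

text \<open>Finiteness is required separately because \<^const>\<open>card\<close> is 0 on infinite sets.\<close>

definition regular_digraph :: "'a pair_pre_digraph \<Rightarrow> nat \<Rightarrow> bool" where
  "regular_digraph G d \<longleftrightarrow>
     (\<forall>x\<in>pverts G. finite (out_nbrs G x) \<and> card (out_nbrs G x) = d)"

definition vertex_transitive :: "'a pair_pre_digraph \<Rightarrow> bool" where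
  "vertex_transitive G \<longleftrightarrow> (\<forall>x\<in>pverts G. \<forall>y\<in>pverts G. \<exists>f.
     pre_digraph.digraph_isomorphism (with_proj G) f \<and>
     app_iso f (with_proj G) = with_proj G \<and> iso_verts f x = y)"

text \<open>The graph distance is the library's shortest-path cost for unit arc weights.\<close>

definition dist_sphere :: "'a pair_pre_digraph \<Rightarrow> 'a \<Rightarrow> nat \<Rightarrow> 'a set" where
  "dist_sphere G r n =
     {x \<in> pverts G. wf_digraph.\<mu> (with_proj G) (\<lambda>_. 1) r x = ereal (real n)}"

lemma vertex_transitive_iff:
  assumes "pair_wf_digraph G"
  shows "vertex_transitive G \<longleftrightarrow> (\<forall>x\<in>pverts G. \<forall>y\<in>pverts G. \<exists>h.
     bij_betw h (pverts G) (pverts G) \<and>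
     (\<forall>u\<in>pverts G. \<forall>v\<in>pverts G. (u, v) \<in> parcs G \<longleftrightarrow> (h u, h v) \<in> parcs G) \<and> h x = y)"
    (is "_ \<longleftrightarrow> ?R")
proof
  interpret pair_wf_digraph G by fact
  assume vt: "vertex_transitive G"
  show ?R
  proof (intro ballI)
    fix x y assume "x \<in> pverts G" "y \<in> pverts G"
    with vt obtain f where f: "pre_digraph.digraph_isomorphism (with_proj G) f"
      "app_iso f (with_proj G) = with_proj G" "iso_verts f x = y"
      unfolding vertex_transitive_def by blast
    let ?h = "iso_verts f"
    have inj: "inj_on ?h (pverts G)" and fs: "\<And>a. a \<in> parcs G \<Longrightarrow>
        ?h (fst a) = iso_tail f (iso_arcs f a) \<and> ?h (snd a) = iso_head f (iso_arcs f a)"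
      using f(1) unfolding pre_digraph.digraph_isomorphism_def by auto
    have im: "?h ` pverts G = pverts G" "iso_arcs f ` parcs G = parcs G"
      and th: "iso_tail f = fst" "iso_head f = snd"
      using f(2) by (auto simp: app_iso_def with_proj_def)
    have arc: "iso_arcs f a = (?h (fst a), ?h (snd a))" if "a \<in> parcs G" for a
      using fs[OF that] by (simp add: th)
    have "(u, v) \<in> parcs G \<longleftrightarrow> (?h u, ?h v) \<in> parcs G"
      if uv: "u \<in> pverts G" "v \<in> pverts G" for u v
    proof
      assume "(u, v) \<in> parcs G"
      then show "(?h u, ?h v) \<in> parcs G" using arc im(2) by force
    next
      assume "(?h u, ?h v) \<in> parcs G"
      then obtain a where a: "a \<in> parcs G" "(?h u, ?h v) = iso_arcs f a" using im(2) by blast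
      moreover have "fst a \<in> pverts G" "snd a \<in> pverts G"
        using a(1) arc_fst_in_verts arc_snd_in_verts by auto
      ultimately have "fst a = u" "snd a = v"
        using arc[OF a(1)] inj uv by (auto dest: inj_onD)
      with a(1) show "(u, v) \<in> parcs G" by (cases a) auto
    qed
    with inj im f(3) show "\<exists>h. bij_betw h (pverts G) (pverts G) \<and>
       (\<forall>u\<in>pverts G. \<forall>v\<in>pverts G. (u, v) \<in> parcs G \<longleftrightarrow> (h u, h v) \<in> parcs G) \<and> h x = y"
      unfolding bij_betw_def by blast
  qed
next
  interpret pair_wf_digraph G by fact
  assume R: ?R
  show "vertex_transitive G"
    unfolding vertex_transitive_def
  proof (intro ballI)
    fix x y assume "x \<in> pverts G" "y \<in> pverts G"
    with R obtain h where h: "bij_betw h (pverts G) (pverts G)" "h x = y"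
      and arc: "\<And>u v. u \<in> pverts G \<Longrightarrow> v \<in> pverts G \<Longrightarrow> (u, v) \<in> parcs G \<longleftrightarrow> (h u, h v) \<in> parcs G"
      by metis
    let ?f = "\<lparr>iso_verts = h, iso_arcs = map_prod h h, iso_head = snd, iso_tail = fst\<rparr>"
    have inj: "inj_on h (pverts G)" and im: "h ` pverts G = pverts G"
      using h(1) by (auto simp: bij_betw_def)
    have sub: "parcs G \<subseteq> pverts G \<times> pverts G"
      using in_arcsD1 in_arcsD2 by (auto simp: subset_eq)
    have inj2: "inj_on (map_prod h h) (parcs G)"
      using map_prod_inj_on[OF inj inj] sub inj_on_subset by blast
    have im2: "map_prod h h ` parcs G = parcs G"
    proof
      show "map_prod h h ` parcs G \<subseteq> parcs G" using arc sub by auto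
      show "parcs G \<subseteq> map_prod h h ` parcs G"
      proof
        fix a assume a: "a \<in> parcs G"
        then have "fst a \<in> h ` pverts G" "snd a \<in> h ` pverts G"
          unfolding im by (simp_all add: arc_fst_in_verts arc_snd_in_verts)
        then obtain u v where uv: "u \<in> pverts G" "v \<in> pverts G" "fst a = h u" "snd a = h v"
          by (elim imageE)
        then have a_eq: "a = map_prod h h (u, v)" by (simp add: prod_eq_iff)
        with a arc[OF uv(1,2)] have "(u, v) \<in> parcs G" by simp
        then show "a \<in> map_prod h h ` parcs G" unfolding a_eq by (rule imageI)
      qed
    qed
    have "wf_digraph (with_proj G)" by unfold_locales
    with inj inj2 have "pre_digraph.digraph_isomorphism (with_proj G) ?f"
      unfolding pre_digraph.digraph_isomorphism_def by auto
    moreover have "app_iso ?f (with_proj G) = with_proj G"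
      by (simp add: app_iso_def with_proj_def im im2)
    ultimately show "\<exists>f. pre_digraph.digraph_isomorphism (with_proj G) f \<and>
        app_iso f (with_proj G) = with_proj G \<and> iso_verts f x = y"
      using h(2) by (intro exI[of _ ?f]) simp
  qed
qed

lemma (in pair_wf_digraph) awalk_length_iff:
  "(\<exists>p. awalk u p v \<and> length p = n) \<longleftrightarrow> u \<in> pverts G \<and> (u, v) \<in> parcs G ^^ n"
proof (induction n arbitrary: u)
  case 0
  then show ?case by (auto simp: awalk_Nil_iff)
next
  case (Suc n)
  have "(\<exists>p. awalk u p v \<and> length p = Suc n) \<longleftrightarrow>
      (\<exists>w. (u, w) \<in> parcs G \<and> (\<exists>p. awalk w p v \<and> length p = n))"
  proof
    assume "\<exists>p. awalk u p v \<and> length p = Suc n"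
    then obtain e q where "awalk u (e # q) v" "length q = n"
      by (auto simp: length_Suc_conv)
    then show "\<exists>w. (u, w) \<in> parcs G \<and> (\<exists>p. awalk w p v \<and> length p = n)"
      by (intro exI[of _ "snd e"]) (auto simp: awalk_Cons_iff)
  next
    assume "\<exists>w. (u, w) \<in> parcs G \<and> (\<exists>p. awalk w p v \<and> length p = n)"
    then obtain w q where "(u, w) \<in> parcs G" "awalk w q v" "length q = n" by blast
    then show "\<exists>p. awalk u p v \<and> length p = Suc n"
      by (intro exI[of _ "(u, w) # q"]) (simp add: awalk_Cons_iff)
  qed
  also have "\<dots> \<longleftrightarrow> (\<exists>w. (u, w) \<in> parcs G \<and> w \<in> pverts G \<and> (w, v) \<in> parcs G ^^ n)"
    by (simp only: Suc.IH)
  also have "\<dots> \<longleftrightarrow> u \<in> pverts G \<and> (u, v) \<in> parcs G ^^ Suc n"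
    using in_arcsD1 in_arcsD2 relpow_Suc_I2 relpow_Suc_D2 by metis
  finally show ?case .
qed

lemma mem_dist_sphere_iff:
  assumes "pair_wf_digraph G" and r: "r \<in> pverts G"
  shows "x \<in> dist_sphere G r n \<longleftrightarrow>
     (r, x) \<in> parcs G ^^ n \<and> (\<forall>m<n. (r, x) \<notin> parcs G ^^ m)"
proof -
  interpret pair_wf_digraph G by fact
  have cost: "awalk_cost (\<lambda>_. 1) p = real (length p)" for p
    by (induction p) auto
  have val: "\<mu> (\<lambda>_. 1) r x = ereal (real (length p))"
    if "awalk r p x" "\<forall>q. awalk r q x \<longrightarrow> length p \<le> length q" for p
    unfolding \<mu>_def using that by (intro antisym INF_greatest INF_lower2[of p]) (auto simp: cost)
  have "\<mu> (\<lambda>_. 1) r x = ereal (real n) \<longleftrightarrow>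
      (\<exists>p. awalk r p x \<and> length p = n \<and> (\<forall>q. awalk r q x \<longrightarrow> length p \<le> length q))"
  proof (cases "\<exists>p. awalk r p x")
    case True
    then obtain p where p: "awalk r p x" "\<forall>q. awalk r q x \<longrightarrow> length p \<le> length q"
      using ex_has_least_nat[of "\<lambda>p. awalk r p x" _ length] by blast
    with val[OF p] show ?thesis by (auto intro: le_antisym)
  next
    case False
    then have "{p. awalk r p x} = {}" by blast
    then have "\<mu> (\<lambda>_. 1) r x = \<infinity>" unfolding \<mu>_def by (simp add: top_ereal_def)
    with False show ?thesis by simp
  qed
  also have "\<dots> \<longleftrightarrow> (\<exists>p. awalk r p x \<and> length p = n) \<and> (\<forall>m<n. \<not> (\<exists>p. awalk r p x \<and> length p = m))"
    by (metis linorder_not_le)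
  also have "\<dots> \<longleftrightarrow> (r, x) \<in> parcs G ^^ n \<and> (\<forall>m<n. (r, x) \<notin> parcs G ^^ m)"
    unfolding awalk_length_iff using r by simp
  finally have *: "\<mu> (\<lambda>_. 1) r x = ereal (real n) \<longleftrightarrow>
      (r, x) \<in> parcs G ^^ n \<and> (\<forall>m<n. (r, x) \<notin> parcs G ^^ m)" .
  have "x \<in> pverts G" if "(r, x) \<in> parcs G ^^ n"
    using that r wellformed' by (cases n) auto
  with * show ?thesis unfolding dist_sphere_def by auto
qed

section \<open>The random configuration\<close>

definition state_law :: "'a pair_pre_digraph \<Rightarrow> nat \<Rightarrow> (nat \<Rightarrow> real) \<Rightarrow> 'a \<Rightarrow> 'a set measure" where
  "state_law G d p x = point_measure (Pow (out_nbrs G x))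
     (\<lambda>S. ennreal (p (card S) / real (d choose card S)))"

definition config_measure ::
  "'a pair_pre_digraph \<Rightarrow> nat \<Rightarrow> (nat \<Rightarrow> real) \<Rightarrow> ('a \<Rightarrow> 'a set) measure" where
  "config_measure G d p = (\<Pi>\<^sub>M x\<in>pverts G. state_law G d p x)"

definition open_arcs :: "'a pair_pre_digraph \<Rightarrow> ('a \<Rightarrow> 'a set) \<Rightarrow> 'a rel" where
  "open_arcs G \<omega> = {(x, y). x \<in> pverts G \<and> y \<in> \<omega> x}"

definition strong_rel :: "'a pair_pre_digraph \<Rightarrow> ('a \<Rightarrow> 'a set) \<Rightarrow> 'a rel" where
  "strong_rel G \<omega> = {(x, y). (x, y) \<in> open_arcs G \<omega> \<and> (y, x) \<in> open_arcs G \<omega>}\<^sup>*"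

definition strong_cluster :: "'a pair_pre_digraph \<Rightarrow> ('a \<Rightarrow> 'a set) \<Rightarrow> 'a \<Rightarrow> 'a set" where
  "strong_cluster G \<omega> r = {x \<in> pverts G. (r, x) \<in> strong_rel G \<omega>}"

text \<open>Counting measure gives the cardinality in \<open>[0, \<infinity>]\<close>, so an infinite cluster counts as
  \<open>\<infinity>\<close> (and not as 0, as it would with \<^const>\<open>card\<close>).\<close>

definition strong_susceptibility ::
  "'a pair_pre_digraph \<Rightarrow> nat \<Rightarrow> (nat \<Rightarrow> real) \<Rightarrow> 'a \<Rightarrow> ennreal" where
  "strong_susceptibility G d p r =
     (\<integral>\<^sup>+ \<omega>. emeasure (count_space (pverts G)) (strong_cluster G \<omega> r) \<partial>config_measure G d p)"

definition reaches_sphere ::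
  "'a pair_pre_digraph \<Rightarrow> nat \<Rightarrow> (nat \<Rightarrow> real) \<Rightarrow> 'a \<Rightarrow> nat \<Rightarrow> ('a \<Rightarrow> 'a set) set" where
  "reaches_sphere G d p r n =
     {\<omega> \<in> space (config_measure G d p). \<exists>x\<in>dist_sphere G r n. (r, x) \<in> strong_rel G \<omega>}"

lemma prob_space_state_law:
  assumes "regular_digraph G d" "x \<in> pverts G"
    and p: "\<And>i. i \<le> d \<Longrightarrow> 0 \<le> p i" "(\<Sum>i\<le>d. p i) = 1"
  shows "prob_space (state_law G d p x)"
proof
  let ?L = "out_nbrs G x"
  have L: "finite ?L" "card ?L = d" using assms by (auto simp: regular_digraph_def)
  have le: "card S \<le> d" if "S \<in> Pow ?L" for S using that L card_mono by blast
  have "(\<Sum>S\<in>Pow ?L. p (card S) / real (d choose card S)) =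
      (\<Sum>k\<le>d. \<Sum>S\<in>{S\<in>Pow ?L. card S = k}. p (card S) / real (d choose card S))"
    using L le by (intro sum.group[symmetric]) auto
  also have "\<dots> = (\<Sum>k\<le>d. p k)"
  proof (rule sum.cong)
    fix k assume "k \<in> {..d}"
    moreover have "card {S\<in>Pow ?L. card S = k} = d choose k"
      using n_subsets[OF L(1), of k] L(2) by simp
    ultimately show "(\<Sum>S\<in>{S\<in>Pow ?L. card S = k}. p (card S) / real (d choose card S)) = p k"
      by simp
  qed simp
  finally have "(\<Sum>S\<in>Pow ?L. ennreal (p (card S) / real (d choose card S))) = 1"
    using p le by (subst sum_ennreal) auto
  then show "emeasure (state_law G d p x) (space (state_law G d p x)) = 1"
    using L by (simp add: state_law_def space_point_measure emeasure_point_measure_finite)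
qed

lemma prob_space_config_measure:
  assumes "regular_digraph G d" "\<And>i. i \<le> d \<Longrightarrow> 0 \<le> p i" "(\<Sum>i\<le>d. p i) = 1"
  shows "prob_space (config_measure G d p)"
  unfolding config_measure_def using prob_space_state_law[OF assms(1) _ assms(2,3)]
  by (intro prob_space_PiM) auto

lemma space_config_measure:
  "space (config_measure G d p) = (\<Pi>\<^sub>E x\<in>pverts G. Pow (out_nbrs G x))"
  by (simp add: config_measure_def space_PiM state_law_def space_point_measure)

lemma measurable_strong_rel:
  assumes "countable (pverts G)"
  shows "{\<omega> \<in> space (config_measure G d p). (x, y) \<in> strong_rel G \<omega>} \<in> sets (config_measure G d p)"
proof -
  let ?M = "config_measure G d p"
  let ?R = "\<lambda>\<omega>. {(x, y). (x, y) \<in> open_arcs G \<omega> \<and> (y, x) \<in> open_arcs G \<omega>}"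
  have arc: "{\<omega> \<in> space ?M. (u, v) \<in> open_arcs G \<omega>} \<in> sets ?M" for u v
  proof (cases "u \<in> pverts G")
    case True
    then have "(\<lambda>\<omega>. \<omega> u) \<in> measurable ?M (state_law G d p u)"
      unfolding config_measure_def by measurable
    then have "(\<lambda>\<omega>. \<omega> u) -` {S \<in> Pow (out_nbrs G u). v \<in> S} \<inter> space ?M \<in> sets ?M"
      by (rule measurable_sets) (auto simp: state_law_def sets_point_measure)
    also have "(\<lambda>\<omega>. \<omega> u) -` {S \<in> Pow (out_nbrs G u). v \<in> S} \<inter> space ?M =
        {\<omega> \<in> space ?M. (u, v) \<in> open_arcs G \<omega>}"
      using True by (auto simp: open_arcs_def space_config_measure)
    finally show ?thesis .
  qed (auto simp: open_arcs_def)
  have step: "{\<omega> \<in> space ?M. (u, v) \<in> ?R \<omega>} \<in> sets ?M" for u v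
    using sets.Int[OF arc[of u v] arc[of v u]] by (rule back_subst) auto
  have pow: "{\<omega> \<in> space ?M. (x, v) \<in> ?R \<omega> ^^ n} \<in> sets ?M" for n v
  proof (induction n arbitrary: v)
    case (Suc n)
    have "{\<omega> \<in> space ?M. (x, v) \<in> ?R \<omega> ^^ Suc n} = (\<Union>z\<in>pverts G.
        {\<omega> \<in> space ?M. (x, z) \<in> ?R \<omega> ^^ n} \<inter> {\<omega> \<in> space ?M. (z, v) \<in> ?R \<omega>})"
      by (auto simp: open_arcs_def)
    then show ?case
      using assms Suc step by (auto intro!: sets.countable_UN')
  qed auto
  have "{\<omega> \<in> space ?M. (x, y) \<in> strong_rel G \<omega>} =
      (\<Union>n. {\<omega> \<in> space ?M. (x, y) \<in> ?R \<omega> ^^ n})"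
    by (auto simp: strong_rel_def rtrancl_power)
  with pow show ?thesis by auto
qed

lemma reaches_sphere_sets:
  assumes "countable (pverts G)"
  shows "reaches_sphere G d p r n \<in> sets (config_measure G d p)"
proof -
  have "reaches_sphere G d p r n = (\<Union>x\<in>dist_sphere G r n.
      {\<omega> \<in> space (config_measure G d p). (r, x) \<in> strong_rel G \<omega>})"
    by (auto simp: reaches_sphere_def)
  moreover have "countable (dist_sphere G r n)"
    using assms by (rule countable_subset[rotated]) (auto simp: dist_sphere_def)
  ultimately show ?thesis
    using measurable_strong_rel[OF assms] by (auto intro!: sets.countable_UN')
qed

lemma cluster_size_measurable:
  assumes "countable (pverts G)" "infinite (pverts G)"
  shows "(\<lambda>\<omega>. emeasure (count_space (pverts G)) (strong_cluster G \<omega> r))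
     \<in> borel_measurable (config_measure G d p)"
proof -
  let ?M = "config_measure G d p" and ?e = "from_nat_into (pverts G)"
  have bij: "bij_betw ?e UNIV (pverts G)" using assms by (rule bij_betw_from_nat_into)
  have "emeasure (count_space (pverts G)) (strong_cluster G \<omega> r) =
      (\<Sum>n. indicator {\<omega>. (r, ?e n) \<in> strong_rel G \<omega>} \<omega>)" for \<omega>
  proof -
    have "emeasure (count_space (pverts G)) (strong_cluster G \<omega> r) =
        (\<integral>\<^sup>+ x. indicator (strong_cluster G \<omega> r) x \<partial>count_space (pverts G))"
      by (subst nn_integral_indicator) (auto simp: strong_cluster_def)
    also have "\<dots> = (\<integral>\<^sup>+ n. indicator (strong_cluster G \<omega> r) (?e n) \<partial>count_space UNIV)"
      by (rule nn_integral_bij_count_space[OF bij, symmetric])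
    also have "\<dots> = (\<Sum>n. indicator (strong_cluster G \<omega> r) (?e n))"
      by (rule nn_integral_count_space_nat)
    also have "\<dots> = (\<Sum>n. indicator {\<omega>. (r, ?e n) \<in> strong_rel G \<omega>} \<omega>)"
      using bij_betwE[OF bij]
      by (intro suminf_cong) (auto simp: strong_cluster_def indicator_def)
    finally show ?thesis .
  qed
  moreover have "(\<lambda>\<omega>. indicator {\<omega>. (r, z) \<in> strong_rel G \<omega>} \<omega> :: ennreal) \<in> borel_measurable ?M" for z
    using measurable_strong_rel[OF assms(1), of d p r z]
    by (subst borel_measurable_indicator_iff) (auto simp: Int_def conj_commute)
  ultimately show ?thesis by simp
qed

end

theory Submission
  imports Defs
begin

text \<open>A shortest open path from the origin to \<open>\<partial>B(n + 1 + m)\<close> splits at a vertex \<open>x \<in> \<partial>B(n)\<close> into a path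
  from \<open>o\<close> to \<open>x\<close> and a vertex-disjoint path from a neighbour \<open>y\<close> of \<open>x\<close> to distance \<open>m\<close> from \<open>y\<close>.
  The states at distinct vertices are independent, but the state at a single vertex need not be
  positively associated, so the elementary BK inequality is not available; Reimer's inequality is.
  With vertex transitivity it gives
  \<open>\<theta>(n + 1 + m) \<le> d (\<Sum>x\<in>\<partial>B(n). P(o \<leftrightarrow> x)) \<theta>(m)\<close> for \<open>\<theta>(n) = P(o \<leftrightarrow> \<partial>B(n))\<close>. The sums over the spheres
  add up to at most the susceptibility, so for some \<open>n\<close> the factor is at most \<open>1/2\<close>.\<close>

section \<open>Reimer's butterfly lemma\<close>

lemma sum_Pow_prod:
  fixes F :: "'i \<Rightarrow> bool \<Rightarrow> 'b::comm_semiring_1"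
  assumes "finite J"
  shows "(\<Sum>z\<in>Pow J. \<Prod>i\<in>J. F i (i \<in> z)) = (\<Prod>i\<in>J. F i True + F i False)"
proof -
  have "(\<Prod>i\<in>J. F i (i \<in> z)) = (\<Prod>i\<in>z. F i True) * (\<Prod>i\<in>J - z. F i False)"
    if "z \<in> Pow J" for z
    using prod.subset_diff[of z J "\<lambda>i. F i (i \<in> z)"] that assms by (simp add: mult.commute)
  then show ?thesis by (simp add: prod_add[OF assms])
qed

text \<open>Gaussian elimination without division: a nontrivial equation is solved for one unknown
  \<open>x0\<close>, and cross-multiplication by the pivot keeps the remaining coefficients
  integral. Integrality is needed because independence is tested modulo 5 later.\<close>

lemma homogeneous_system_int:
  fixes f :: "'z \<Rightarrow> 'x \<Rightarrow> int"
  assumes "finite Z" "finite X" "card Z < card X"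
  shows "\<exists>c. (\<exists>x\<in>X. c x \<noteq> 0) \<and> (\<forall>z\<in>Z. (\<Sum>x\<in>X. c x * f z x) = 0)"
  using assms
proof (induction Z arbitrary: X f rule: finite_induct)
  case empty
  then obtain x where "x \<in> X" by (metis card.empty less_irrefl ex_in_conv)
  then show ?case by (intro exI[of _ "\<lambda>_. 1"]) auto
next
  case (insert z Z)
  show ?case
  proof (cases "\<forall>x\<in>X. f z x = 0")
    case True
    have "card Z < card X" using insert by simp
    from insert.IH[OF insert.prems(1) this, of f] True show ?thesis by auto
  next
    case False
    then obtain x0 where x0: "x0 \<in> X" "f z x0 \<noteq> 0" by blast
    let ?X = "X - {x0}" and ?a = "f z x0"
    have "card Z < card ?X" using insert x0 by simp
    from insert.IH[OF _ this, of "\<lambda>y x. ?a * f y x - f z x * f y x0"] insert.prems(1)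
    obtain c where c: "\<exists>x\<in>?X. c x \<noteq> 0"
      "\<And>y. y \<in> Z \<Longrightarrow> (\<Sum>x\<in>?X. c x * (?a * f y x - f z x * f y x0)) = 0" by auto
    \<comment> \<open>Scaling the other unknowns by the pivot \<open>?a\<close> makes the value at
      \<open>x0\<close> that solves equation \<open>z\<close> an integer.\<close>
    define c' where "c' = (\<lambda>x. if x = x0 then - (\<Sum>x\<in>?X. c x * f z x) else ?a * c x)"
    have split: "(\<Sum>x\<in>X. c' x * f y x) =
        (\<Sum>x\<in>?X. ?a * c x * f y x) - (\<Sum>x\<in>?X. c x * f z x) * f y x0" for y
    proof -
      have "(\<Sum>x\<in>?X. c' x * f y x) = (\<Sum>x\<in>?X. ?a * c x * f y x)"
        by (intro sum.cong) (auto simp: c'_def)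
      then show ?thesis
        using sum.remove[OF insert.prems(1) x0(1), of "\<lambda>x. c' x * f y x"] by (simp add: c'_def)
    qed
    have "(\<Sum>x\<in>X. c' x * f y x) = 0" if "y \<in> Set.insert z Z" for y
    proof (cases "y = z")
      case True
      then show ?thesis
        unfolding split by (simp add: sum_distrib_left sum_distrib_right mult_ac)
    next
      case False
      with that c(2) have "(\<Sum>x\<in>?X. c x * (?a * f y x - f z x * f y x0)) = 0" by blast
      then show ?thesis
        unfolding split by (simp add: sum_distrib_left sum_subtractf algebra_simps)
    qed
    moreover have "\<exists>x\<in>X. c' x \<noteq> 0" using c(1) x0 by (auto simp: c'_def)
    ultimately show ?thesis by blast
  qed
qed

text \<open>As long as \<open>k\<close> divides every entry, dividing by it strictly lowers the sum
  of absolute values, so the process stops. With \<open>k = 5\<close> this turns a nonzero solution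
  into one that is nonzero modulo 5.\<close>

lemma primitive_int_family:
  fixes c :: "'x \<Rightarrow> int"
  assumes "finite X" "\<exists>x\<in>X. c x \<noteq> 0" and k: "1 < k"
  shows "\<exists>c' m. m \<noteq> 0 \<and> (\<forall>x\<in>X. c x = m * c' x) \<and> (\<exists>x\<in>X. \<not> k dvd c' x)"
  using assms(2)
proof (induction "\<Sum>x\<in>X. nat \<bar>c x\<bar>" arbitrary: c rule: less_induct)
  case less
  show ?case
  proof (cases "\<forall>x\<in>X. k dvd c x")
    case False
    then show ?thesis by (intro exI[of _ c] exI[of _ 1]) auto
  next
    case True
    define e where "e = (\<lambda>x. c x div k)"
    have e: "c x = k * e x" if "x \<in> X" for x using True that by (simp add: e_def)
    have le: "nat \<bar>e x\<bar> \<le> nat \<bar>c x\<bar>" if "x \<in> X" for x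
      using k e[OF that] mult_right_mono[of 1 k "\<bar>e x\<bar>"] by (simp add: abs_mult)
    obtain x where x: "x \<in> X" "c x \<noteq> 0" using less.prems by blast
    have "e x \<noteq> 0" using x e by force
    have "nat \<bar>e x\<bar> < nat \<bar>c x\<bar>"
      using k e[OF x(1)] \<open>e x \<noteq> 0\<close> mult_strict_right_mono[of 1 k "\<bar>e x\<bar>"] by (simp add: abs_mult)
    then have "(\<Sum>x\<in>X. nat \<bar>e x\<bar>) < (\<Sum>x\<in>X. nat \<bar>c x\<bar>)"
      using le x assms(1) by (intro sum_strict_mono_ex1) auto
    from less.hyps[OF this] x(1) \<open>e x \<noteq> 0\<close> obtain c' m where
      "m \<noteq> 0" "\<forall>x\<in>X. e x = m * c' x" "\<exists>x\<in>X. \<not> k dvd c' x" by blast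
    then show ?thesis using e k by (intro exI[of _ c'] exI[of _ "k * m"]) auto
  qed
qed

text \<open>Four integer vectors \<open>w = gram_vec k x\<close> in the plane with \<open>gram_vec True x\<close> orthogonal to
  \<open>gram_vec False x\<close> (\<open>k\<close> says whether a coordinate belongs to the first witness, \<open>x\<close> is its value),
  together with \<open>A w\<close> and \<open>4 A\<^sup>-\<^sup>T w\<close> for \<open>A = (4, 3; 0, 1)\<close>. In these images the orthogonality becomes
  a vanishing entry, so that their tensor products are supported on cylinders.
  Modulo 5, \<open>gram_vec k True\<close> is a multiple of \<open>(1, 2)\<close>, which \<open>dual_vec False\<close> annihilates.\<close>

fun red_vec :: "bool \<Rightarrow> bool \<Rightarrow> bool \<Rightarrow> int" where
  "red_vec True x t = (if t = x then 4 else 0)"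
| "red_vec False False t = (if t then 1 else 3)"
| "red_vec False True t = (if t then 3 else 25)"

fun yellow_vec :: "bool \<Rightarrow> bool \<Rightarrow> bool \<Rightarrow> int" where
  "yellow_vec False x t = (if t = x then 0 else 4)"
| "yellow_vec True False t = (if t then -3 else 1)"
| "yellow_vec True True t = (if t then 25 else -3)"

fun gram_vec :: "bool \<Rightarrow> bool \<Rightarrow> bool \<Rightarrow> int" where
  "gram_vec True False t = (if t then 0 else 1)"
| "gram_vec False False t = (if t then 1 else 0)"
| "gram_vec True True t = (if t then 4 else -3)"
| "gram_vec False True t = (if t then 3 else 4)"

fun dual_vec :: "bool \<Rightarrow> bool \<Rightarrow> int" where
  "dual_vec False t = (if t then -1 else 2)"
| "dual_vec True t = (if t then 0 else 1)"

text \<open>One side carries \<open>A\<close> and the other \<open>4 A^-T\<close>, so the matrices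
  cancel in the pairing and leave the factor 4.\<close>

lemma red_yellow:
  "red_vec k x True * yellow_vec l y True + red_vec k x False * yellow_vec l y False =
   4 * (gram_vec k x True * gram_vec l y True + gram_vec k x False * gram_vec l y False)"
  by (cases k; cases x; cases l; cases y) simp_all

lemma dual_dvd: "5 dvd dual_vec False True * gram_vec k True True + dual_vec False False * gram_vec k True False"
  by (cases k) simp_all

text \<open>These are the diagonal factors 2, -1, -3 and 4 of the triangular system, all invertible
  modulo 5.\<close>

lemma dual_not_dvd:
  "\<not> 5 dvd dual_vec x True * gram_vec k x True + dual_vec x False * gram_vec k x False"
  by (cases k; cases x) simp_all

text \<open>A tensor product of planar vectors, read as a function on the cube \<open>Pow J\<close>:
  \<open>D\<close> and \<open>z\<close> are points of the cube, encoded as subsets, and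
  \<open>K\<close> is the coordinate set of the first witness.\<close>

definition tensor :: "'i set \<Rightarrow> (bool \<Rightarrow> bool \<Rightarrow> bool \<Rightarrow> int) \<Rightarrow> 'i set \<Rightarrow> 'i set \<Rightarrow> 'i set \<Rightarrow> int" where
  "tensor J v K D z = (\<Prod>i\<in>J. v (i \<in> K) (i \<in> D) (i \<in> z))"

lemma sum_tensor_mult:
  assumes "finite J"
  shows "(\<Sum>z\<in>Pow J. tensor J u K D z * tensor J v L E z) =
    (\<Prod>i\<in>J. u (i \<in> K) (i \<in> D) True * v (i \<in> L) (i \<in> E) True +
              u (i \<in> K) (i \<in> D) False * v (i \<in> L) (i \<in> E) False)"
  using sum_Pow_prod[OF assms, of "\<lambda>i t. u (i \<in> K) (i \<in> D) t * v (i \<in> L) (i \<in> E) t"]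
  by (simp add: tensor_def prod.distrib)

text \<open>Modulo 5 the system is triangular with respect to inclusion, whatever \<open>K\<close> is.\<close>

lemma gram_tensor_independent:
  assumes J: "finite J" and X: "X \<subseteq> Pow J"
    and zero: "\<And>z. z \<in> Pow J \<Longrightarrow> (\<Sum>D\<in>X. c D * tensor J gram_vec (K D) D z) = 0"
    and "D \<in> X"
  shows "5 dvd c D"
proof -
  have fX: "finite X" using J X finite_subset by blast
  have "finite D" if "D \<in> X" for D using that X J finite_subset by blast
  then show ?thesis using \<open>D \<in> X\<close>
  proof (induction "card D" arbitrary: D rule: less_induct)
    case less
    \<comment> \<open>The relation is tested against the dual tensor of \<open>D\<close>. The
      argument \<open>{}\<close> is a placeholder, since \<open>dual_vec\<close> ignores the witness
      set.\<close>
    let ?u = "tensor J (\<lambda>_. dual_vec) {} D"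
    let ?g = "\<lambda>E. \<Sum>z\<in>Pow J. ?u z * tensor J gram_vec (K E) E z"
    have g: "?g E = (\<Prod>i\<in>J. dual_vec (i \<in> D) True * gram_vec (i \<in> K E) (i \<in> E) True +
        dual_vec (i \<in> D) False * gram_vec (i \<in> K E) (i \<in> E) False)" for E
      by (simp add: sum_tensor_mult[OF J])
    have "(\<Sum>E\<in>X. c E * ?g E) = (\<Sum>z\<in>Pow J. ?u z * (\<Sum>E\<in>X. c E * tensor J gram_vec (K E) E z))"
      by (simp add: sum_distrib_left mult_ac) (rule sum.swap)
    also have "\<dots> = 0" using zero by simp
    finally have "c D * ?g D = - (\<Sum>E\<in>X - {D}. c E * ?g E)"
      using sum.remove[OF fX less.prems(2), of "\<lambda>E. c E * ?g E"] by simp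
    moreover have "5 dvd (\<Sum>E\<in>X - {D}. c E * ?g E)"
    proof (rule dvd_sum)
      \<comment> \<open>If \<open>E\<close> is a proper subset of \<open>D\<close>, induction
        applies to \<open>c E\<close>; otherwise a coordinate in \<open>E - D\<close> contributes a
        factor divisible by 5.\<close>
      fix E assume E: "E \<in> X - {D}"
      show "5 dvd c E * ?g E"
      proof (cases "E \<subseteq> D")
        case True
        with E have "card E < card D"
          using less.prems(1)[OF less.prems(2)] by (intro psubset_card_mono) auto
        with less.hyps[of E] less.prems(1) E show ?thesis by simp
      next
        case False
        then obtain i where i: "i \<in> E" "i \<notin> D" by blast
        with E X have "i \<in> J" by blast
        with i dual_dvd[of "i \<in> K E"] have "5 dvd ?g E"
          unfolding g by (intro dvd_trans[OF _ dvd_prodI[OF J, of i]]) simp_all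
        then show ?thesis by simp
      qed
    qed
    ultimately have "5 dvd c D * ?g D" by simp
    moreover have "prime (5::int)" by simp
    moreover have "\<not> 5 dvd ?g D"
      unfolding g using dual_not_dvd prime_dvd_prod_iff[OF J \<open>prime 5\<close>] by auto
    ultimately show ?case using prime_dvd_mult_iff by blast
  qed
qed

text \<open>If the conclusion failed, a nontrivial combination of the yellow tensors would vanish on all of
  \<open>A\<close>, hence be orthogonal to all red tensors; the corresponding combination of the Gram tensors then
  has norm 0, contradicting their independence.\<close>

lemma butterfly:
  assumes J: "finite J" and X: "X \<subseteq> Pow J"
    and A: "\<And>D E. D \<in> X \<Longrightarrow> E \<subseteq> J \<Longrightarrow> E \<inter> K D = D \<inter> K D \<Longrightarrow> E \<in> A"
    and B: "\<And>D E. D \<in> X \<Longrightarrow> E \<subseteq> J \<Longrightarrow> E - K D = D - K D \<Longrightarrow> E \<in> B"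
  shows "card X \<le> card {E \<in> Pow J. E \<in> A \<and> J - E \<in> B}"
proof (rule ccontr)
  let ?Z = "{E \<in> Pow J. E \<in> A \<and> J - E \<in> B}"
  assume "\<not> ?thesis"
  then have less: "card ?Z < card X" by simp
  have fX: "finite X" using J X finite_subset by blast
  \<comment> \<open>\<open>red_vec True x\<close> vanishes off \<open>x\<close>, so the red tensor
    lives on the points that agree with \<open>D\<close> on \<open>K D\<close>; these lie in
    \<open>A\<close>.\<close>
  have red0: "tensor J red_vec (K D) D z = 0" if D: "D \<in> X" and z: "z \<in> Pow J" "z \<notin> A" for D z
  proof -
    have "z \<inter> K D \<noteq> D \<inter> K D" using A[OF D] z by blast
    then obtain i where "i \<in> K D" "(i \<in> z) \<noteq> (i \<in> D)" by blast
    moreover then have "i \<in> J" using D X z by blast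
    ultimately show ?thesis unfolding tensor_def by (intro prod_zero J bexI[of _ i]) auto
  qed
  \<comment> \<open>\<open>yellow_vec False x\<close> vanishes at \<open>x\<close>, so the yellow
    tensor lives on the points whose complement agrees with \<open>D\<close> off \<open>K D\<close>;
    these complements lie in \<open>B\<close>.\<close>
  have yellow0: "tensor J yellow_vec (K D) D z = 0"
    if D: "D \<in> X" and z: "z \<in> Pow J" "J - z \<notin> B" for D z
  proof -
    have "J - z - K D \<noteq> D - K D" using B[OF D, of "J - z"] z by blast
    then obtain i where "i \<notin> K D" "(i \<in> J - z) \<noteq> (i \<in> D)" by blast
    moreover then have "i \<in> J" using D X by blast
    ultimately show ?thesis unfolding tensor_def by (intro prod_zero J bexI[of _ i]) auto
  qed
  \<comment> \<open>One equation for each point of \<open>?Z\<close> and one unknown for each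
    element of \<open>X\<close>: there are more unknowns than equations.\<close>
  obtain c0 where c0: "\<exists>D\<in>X. c0 D \<noteq> 0"
    "\<forall>z\<in>?Z. (\<Sum>D\<in>X. c0 D * tensor J yellow_vec (K D) D z) = 0"
    using homogeneous_system_int[OF _ fX less, of "\<lambda>z D. tensor J yellow_vec (K D) D z"] J by auto
  obtain c m where c: "m \<noteq> 0" "\<forall>D\<in>X. c0 D = m * c D" "\<exists>D\<in>X. \<not> 5 dvd c D"
    using primitive_int_family[OF fX c0(1), of 5] by auto
  define y where "y = (\<lambda>z. \<Sum>D\<in>X. c D * tensor J yellow_vec (K D) D z)"
  have yZ: "y z = 0" if "z \<in> ?Z" for z
  proof -
    have "m * y z = (\<Sum>D\<in>X. c0 D * tensor J yellow_vec (K D) D z)"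
      unfolding y_def sum_distrib_left using c(2) by (intro sum.cong) auto
    with c0(2) that c(1) show ?thesis by auto
  qed
  \<comment> \<open>On \<open>?Z\<close> the combination \<open>y\<close> vanishes by choice of
    \<open>c\<close>. Off \<open>?Z\<close>, either the red tensor vanishes or all yellow ones
    do.\<close>
  have ry: "tensor J red_vec (K D) D z * y z = 0" if "D \<in> X" "z \<in> Pow J" for D z
  proof (cases "z \<in> ?Z")
    case False
    with that consider "z \<notin> A" | "J - z \<notin> B" by blast
    then show ?thesis
      using red0[OF that] yellow0[OF _ that(2)] by cases (simp_all add: y_def)
  qed (simp add: yZ)
  define w where "w = (\<lambda>z. \<Sum>D\<in>X. c D * tensor J gram_vec (K D) D z)"
  have gram: "(\<Sum>z\<in>Pow J. tensor J red_vec (K D) D z * tensor J yellow_vec (K E) E z) =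
      4 ^ card J * (\<Sum>z\<in>Pow J. tensor J gram_vec (K D) D z * tensor J gram_vec (K E) E z)" for D E
    by (simp only: sum_tensor_mult[OF J] red_yellow prod.distrib prod_constant)
  \<comment> \<open>Pairing the red combination with the yellow one, both with coefficients
    \<open>c\<close>, gives 0 by \<open>ry\<close> and \<open>4 ^ card J\<close> times the squared
    norm of \<open>w\<close> by \<open>gram\<close>.\<close>
  have "0 = (\<Sum>D\<in>X. c D * (\<Sum>z\<in>Pow J. tensor J red_vec (K D) D z * y z))"
  proof -
    have "(\<Sum>z\<in>Pow J. tensor J red_vec (K D) D z * y z) = 0" if "D \<in> X" for D
      using ry[OF that] by (rule sum.neutral[OF ballI])
    then show ?thesis by simp
  qed
  also have "\<dots> = (\<Sum>D\<in>X. \<Sum>E\<in>X. c D * c E *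
      (\<Sum>z\<in>Pow J. tensor J red_vec (K D) D z * tensor J yellow_vec (K E) E z))"
    unfolding y_def sum_distrib_left
    by (rule sum.cong[OF refl], subst sum.swap) (simp add: mult_ac)
  also have "\<dots> = 4 ^ card J * (\<Sum>D\<in>X. \<Sum>E\<in>X. \<Sum>z\<in>Pow J.
      (c D * tensor J gram_vec (K D) D z) * (c E * tensor J gram_vec (K E) E z))"
    by (simp add: gram sum_distrib_left mult_ac)
  also have "(\<Sum>D\<in>X. \<Sum>E\<in>X. \<Sum>z\<in>Pow J.
      (c D * tensor J gram_vec (K D) D z) * (c E * tensor J gram_vec (K E) E z)) =
      (\<Sum>z\<in>Pow J. (w z)\<^sup>2)"
    unfolding w_def power2_eq_square sum_product
    by (subst sum.swap[of _ "Pow J"], subst sum.swap[of _ "Pow J"]) (rule refl)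
  finally have "(\<Sum>z\<in>Pow J. (w z)\<^sup>2) = 0" by simp
  then have "w z = 0" if "z \<in> Pow J" for z
    using that J by (subst (asm) sum_nonneg_eq_0_iff) auto
  with gram_tensor_independent[OF J X, of c K] c(3) show False by (auto simp: w_def)
qed

section \<open>The van den Berg--Kesten--Reimer inequality\<close>

text \<open>In the product of two copies, \<open>X s\<close> reads one copy of each coordinate and
  the opposite selector reads the other. The two read disjoint families of independent coordinates,
  and each has the original law.\<close>

lemma complementary_selectors_indep:
  assumes M: "\<And>i. i \<in> I \<Longrightarrow> prob_space (M i)" and ne: "I \<noteq> {}"
    and A: "A \<in> sets (PiM I M)" and B: "B \<in> sets (PiM I M)"
  defines "N \<equiv> PiM (I \<times> (UNIV::bool set)) (\<lambda>j. M (fst j))"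
  defines "X \<equiv> \<lambda>s \<zeta>. \<lambda>i\<in>I. \<zeta> (i, s i)"
  shows "X s \<in> measurable N (PiM I M)"
    and "measure N (X s -` A \<inter> space N) = measure (PiM I M) A"
    and "measure N ((\<lambda>\<zeta>. (X s \<zeta>, X (\<lambda>i. \<not> s i) \<zeta>)) -` (A \<times> B) \<inter> space N) =
      measure (PiM I M) A * measure (PiM I M) B"
proof -
  let ?K = "I \<times> (UNIV::bool set)" and ?s' = "\<lambda>i. \<not> s i"
  let ?M = "\<lambda>j. M (fst j)" and ?G = "\<lambda>s. (\<lambda>i. (i, s i)) ` I"
  interpret N: prob_space N unfolding N_def using M by (intro prob_space_PiM) auto
  have sel: "X s \<in> measurable (PiM L ?M) (PiM I M)" if "?G s \<subseteq> L" for s L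
    unfolding X_def
  proof (rule measurable_restrict)
    fix i assume "i \<in> I"
    with that have "(i, s i) \<in> L" by auto
    from measurable_component_singleton[OF this, of ?M]
    show "(\<lambda>\<zeta>. \<zeta> (i, s i)) \<in> measurable (PiM L ?M) (M i)" by simp
  qed
  show meas: "X s \<in> measurable N (PiM I M)" for s
    unfolding N_def by (rule sel) auto
  have "distr N (PiM I M) (X s) = PiM I M" for s
    using distr_PiM_reindex[of ?K ?M "\<lambda>i. (i, s i)" I] M
    unfolding N_def X_def by (auto simp: inj_on_def)
  then have law: "measure N (X s -` A \<inter> space N) = measure (PiM I M) A"
    if "A \<in> sets (PiM I M)" for s A
    using measure_distr[OF meas that, of s] by simp
  from law[OF A] show "measure N (X s -` A \<inter> space N) = measure (PiM I M) A" .
  have coords: "N.indep_vars ?M (\<lambda>j \<zeta>. \<zeta> j) ?K"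
  proof (subst N.indep_vars_iff_distr_eq_PiM')
    show "?K \<noteq> {}" using ne by auto
    show "(\<lambda>\<zeta>. \<zeta> j) \<in> measurable N (?M j)" if "j \<in> ?K" for j
      unfolding N_def by (intro measurable_component_singleton that)
    have "distr N (PiM ?K ?M) (\<lambda>\<zeta>. \<lambda>j\<in>?K. \<zeta> j) = distr N N (\<lambda>\<zeta>. \<zeta>)"
      by (rule distr_cong) (auto simp: N_def space_PiM PiE_restrict)
    also have "\<dots> = PiM ?K (\<lambda>j. distr N (?M j) (\<lambda>\<zeta>. \<zeta> j))"
      unfolding distr_id N_def using M
      by (intro PiM_cong refl distr_PiM_component[symmetric]) auto
    finally show "distr N (PiM ?K ?M) (\<lambda>\<zeta>. \<lambda>j\<in>?K. \<zeta> j) =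
        PiM ?K (\<lambda>j. distr N (?M j) (\<lambda>\<zeta>. \<zeta> j))" .
  qed
  \<comment> \<open>Each selector factors through the restriction to the graph of its choice
    function; the graphs of \<open>s\<close> and its negation are disjoint.\<close>
  have "N.indep_var (PiM I M) (X s \<circ> (\<lambda>\<zeta>. restrict (\<lambda>j. \<zeta> j) (?G s)))
      (PiM I M) (X ?s' \<circ> (\<lambda>\<zeta>. restrict (\<lambda>j. \<zeta> j) (?G ?s')))"
    by (rule N.indep_var_compose[OF N.indep_var_restrict[OF coords] sel sel]) auto
  moreover have "X s \<circ> (\<lambda>\<zeta>. restrict (\<lambda>j. \<zeta> j) (?G s)) = X s" for s
    by (auto simp: X_def fun_eq_iff)
  ultimately have "N.indep_var (PiM I M) (X s) (PiM I M) (X ?s')" by simp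
  from N.indep_varD[OF this A B] show "measure N ((\<lambda>\<zeta>. (X s \<zeta>, X ?s' \<zeta>)) -` (A \<times> B) \<inter> space N) =
      measure (PiM I M) A * measure (PiM I M) B"
    by (simp add: law A B)
qed

text \<open>Two independent copies are resampled into each other on a set \<open>D \<subseteq> J\<close> of coordinates. For fixed
  values of both copies, averaging over \<open>D\<close> reduces the claim to the butterfly lemma on \<open>Pow J\<close>.\<close>

lemma van_den_Berg_Kesten_Reimer:
  assumes M: "\<And>i. i \<in> I \<Longrightarrow> prob_space (M i)" and ne: "I \<noteq> {}"
    and J: "finite J" "J \<subseteq> I"
    and sets: "W \<in> sets (PiM I M)" "A \<in> sets (PiM I M)" "B \<in> sets (PiM I M)"
    and W: "\<And>\<omega>. \<omega> \<in> W \<Longrightarrow> \<exists>K.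
      (\<forall>\<eta>\<in>space (PiM I M). (\<forall>i\<in>K. \<eta> i = \<omega> i) \<longrightarrow> \<eta> \<in> A) \<and>
      (\<forall>\<eta>\<in>space (PiM I M). (\<forall>i\<in>J - K. \<eta> i = \<omega> i) \<longrightarrow> \<eta> \<in> B)"
  shows "measure (PiM I M) W \<le> measure (PiM I M) A * measure (PiM I M) B"
proof -
  let ?P = "PiM I M"
  define N where "N = PiM (I \<times> (UNIV::bool set)) (\<lambda>j. M (fst j))"
  \<comment> \<open>\<open>Y D\<close> takes copy \<open>True\<close> on \<open>D\<close> and copy
    \<open>False\<close> elsewhere; \<open>Y' D\<close> takes the copies left over.\<close>
  define Y where "Y = (\<lambda>D \<zeta>. \<lambda>i\<in>I. \<zeta> (i, i \<in> D) :: 'b)"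
  define Y' where "Y' = (\<lambda>D \<zeta>. \<lambda>i\<in>I. \<zeta> (i, i \<notin> D) :: 'b)"
  interpret N: prob_space N unfolding N_def using M by (intro prob_space_PiM) auto
  note indep = complementary_selectors_indep[where M = M and I = I, OF M ne, folded N_def]
  have Ymeas: "Y D \<in> measurable N ?P" "Y' D \<in> measurable N ?P" for D
    using indep(1)[OF _ sets(2,3)] unfolding Y_def Y'_def by auto
  let ?U = "\<lambda>D. Y D -` W \<inter> space N"
  let ?V = "\<lambda>D. (\<lambda>\<zeta>. (Y D \<zeta>, Y' D \<zeta>)) -` (A \<times> B) \<inter> space N"
  have Usets: "?U D \<in> sets N" for D
    using measurable_sets[OF Ymeas(1) sets(1)] .
  have Vsets: "?V D \<in> sets N" for D
  proof -
    have "?V D = (Y D -` A \<inter> space N) \<inter> (Y' D -` B \<inter> space N)" by auto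
    then show ?thesis
      using measurable_sets[OF Ymeas(1) sets(2)] measurable_sets[OF Ymeas(2) sets(3)] by auto
  qed
  have pointwise: "card {D \<in> Pow J. \<zeta> \<in> ?U D} \<le> card {D \<in> Pow J. \<zeta> \<in> ?V D}"
    if \<zeta>: "\<zeta> \<in> space N" for \<zeta>
  proof -
    have sp: "Y D \<zeta> \<in> space ?P" "Y' D \<zeta> \<in> space ?P" for D
      using measurable_space[OF Ymeas(1) \<zeta>] measurable_space[OF Ymeas(2) \<zeta>] by auto
    let ?X = "{D \<in> Pow J. Y D \<zeta> \<in> W}"
    have "\<forall>D\<in>?X. \<exists>K. (\<forall>\<eta>\<in>space ?P. (\<forall>i\<in>K. \<eta> i = Y D \<zeta> i) \<longrightarrow> \<eta> \<in> A) \<and>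
        (\<forall>\<eta>\<in>space ?P. (\<forall>i\<in>J - K. \<eta> i = Y D \<zeta> i) \<longrightarrow> \<eta> \<in> B)"
      by (rule ballI, rule W) simp
    from bchoice[OF this] obtain K where "\<forall>D\<in>?X.
        (\<forall>\<eta>\<in>space ?P. (\<forall>i\<in>K D. \<eta> i = Y D \<zeta> i) \<longrightarrow> \<eta> \<in> A) \<and>
        (\<forall>\<eta>\<in>space ?P. (\<forall>i\<in>J - K D. \<eta> i = Y D \<zeta> i) \<longrightarrow> \<eta> \<in> B)" ..
    then have K: "\<And>D \<eta>. D \<in> ?X \<Longrightarrow> \<eta> \<in> space ?P \<Longrightarrow> \<forall>i\<in>K D. \<eta> i = Y D \<zeta> i \<Longrightarrow> \<eta> \<in> A"
      "\<And>D \<eta>. D \<in> ?X \<Longrightarrow> \<eta> \<in> space ?P \<Longrightarrow> \<forall>i\<in>J - K D. \<eta> i = Y D \<zeta> i \<Longrightarrow> \<eta> \<in> B" by blast+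
    have eqK: "i \<in> E \<longleftrightarrow> i \<in> D" if "E \<inter> K D = D \<inter> K D" "i \<in> K D" for E D i
      using that by blast
    have eqK': "i \<in> E \<longleftrightarrow> i \<in> D" if "E - K D = D - K D" "i \<notin> K D" for E D i
      using that by blast
    \<comment> \<open>The second family is indexed by complements because \<open>Y' (J - E)\<close>
      agrees with \<open>Y E\<close> on \<open>J\<close>. Outside \<open>J\<close> they read
      different copies, which is why the second witness has to be \<open>J - K\<close> and not the
      full complement of \<open>K\<close>.\<close>
    have "card ?X \<le> card {E \<in> Pow J. E \<in> {E. Y E \<zeta> \<in> A} \<and> J - E \<in> {E. Y' (J - E) \<zeta> \<in> B}}"
    proof (rule butterfly[OF J(1), where K = K])
      fix D E assume D: "D \<in> ?X" and E: "E \<subseteq> J" "E \<inter> K D = D \<inter> K D"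
      have "Y E \<zeta> i = Y D \<zeta> i" if "i \<in> K D" for i
        using eqK[OF E(2) that] by (simp add: Y_def restrict_def)
      then show "E \<in> {E. Y E \<zeta> \<in> A}"
        using K(1)[OF D sp(1)] by auto
    next
      fix D E assume D: "D \<in> ?X" and E: "E \<subseteq> J" "E - K D = D - K D"
      have "Y' (J - E) \<zeta> i = Y D \<zeta> i" if "i \<in> J - K D" for i
        using eqK'[OF E(2), of i] that by (auto simp: Y_def Y'_def)
      then show "E \<in> {E. Y' (J - E) \<zeta> \<in> B}"
        using K(2)[OF D sp(2)] by auto
    qed auto
    also have "{E \<in> Pow J. E \<in> {E. Y E \<zeta> \<in> A} \<and> J - E \<in> {E. Y' (J - E) \<zeta> \<in> B}} =
        {D \<in> Pow J. \<zeta> \<in> ?V D}"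
      using \<zeta> by (auto simp: double_diff)
    finally show ?thesis using \<zeta> by simp
  qed
  have count: "(\<Sum>D\<in>Pow J. indicator (S D) \<zeta>) = real (card {D \<in> Pow J. \<zeta> \<in> S D})" for S \<zeta>
    using J(1) by (simp add: indicator_def sum.If_cases Int_def)
  have exp: "(\<integral>\<zeta>. (\<Sum>D\<in>Pow J. indicator (S D) \<zeta>) \<partial>N) = (\<Sum>D\<in>Pow J. measure N (S D))"
    if "\<And>D. S D \<in> sets N" for S :: "'a set \<Rightarrow> ('a \<times> bool \<Rightarrow> 'b) set"
    using that by (subst Bochner_Integration.integral_sum) (auto intro!: integrable_real_indicator N.emeasure_finite simp: less_top[symmetric])
  \<comment> \<open>The law of \<open>Y D\<close>, and likewise the joint law of \<open>Y D\<close>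
    and \<open>Y' D\<close>, is the same for every \<open>D\<close>, so integrating the pointwise
    comparison yields \<open>2 ^ card J\<close> times the claim.\<close>
  have "2 ^ card J * measure ?P W = (\<integral>\<zeta>. (\<Sum>D\<in>Pow J. indicator (?U D) \<zeta>) \<partial>N)"
    using indep(2)[OF _ sets(1,3)] unfolding exp[OF Usets]
    by (simp add: Y_def card_Pow J(1))
  also have "\<dots> \<le> (\<integral>\<zeta>. (\<Sum>D\<in>Pow J. indicator (?V D) \<zeta>) \<partial>N)"
  proof (rule integral_mono)
    show "(\<Sum>D\<in>Pow J. indicator (?U D) \<zeta>) \<le> (\<Sum>D\<in>Pow J. indicator (?V D) \<zeta> :: real)"
      if "\<zeta> \<in> space N" for \<zeta>
      unfolding count using pointwise[OF that] by simp
  qed (use Usets Vsets in \<open>auto intro!: Bochner_Integration.integrable_sum integrable_real_indicator simp: less_top[symmetric]\<close>)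
  also have "\<dots> = 2 ^ card J * (measure ?P A * measure ?P B)"
    using indep(3)[OF _ sets(2,3)] unfolding exp[OF Vsets]
    by (simp add: Y_def Y'_def card_Pow J(1))
  finally show ?thesis by simp
qed

section \<open>Splitting a connection to a sphere\<close>

text \<open>A discrete intermediate value argument: the distance from the starting point grows by at
  most one per arc, so the first vertex at distance at least \<open>m\<close> is at distance exactly
  \<open>m\<close>.\<close>

lemma path_meets_dist_sphere:
  assumes G: "pair_wf_digraph G" and "f 0 \<in> pverts G"
    and path: "\<And>i. i < k \<Longrightarrow> (f i, f (Suc i)) \<in> parcs G"
    and far: "\<And>q. q < m \<Longrightarrow> (f 0, f k) \<notin> parcs G ^^ q"
  shows "\<exists>j\<le>k. f j \<in> dist_sphere G (f 0) m"
proof -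
  let ?far = "\<lambda>i. \<forall>q<m. (f 0, f i) \<notin> parcs G ^^ q"
  define j where "j = (LEAST i. ?far i)"
  have "?far k" using far by blast
  then have farj: "?far j" and jk: "j \<le> k"
    unfolding j_def by (rule LeastI, rule Least_le)
  have "(f 0, f j) \<in> parcs G ^^ m"
  proof (cases j)
    case 0
    then have "m = 0" using farj relpow_0_I[of "f 0" "parcs G"] by (metis gr0I)
    with 0 show ?thesis by simp
  next
    case (Suc i)
    then have "i < j" by simp
    then have "\<not> ?far i" unfolding j_def by (rule not_less_Least)
    then obtain q where q: "q < m" "(f 0, f i) \<in> parcs G ^^ q" by blast
    with path[of i] Suc jk have step: "(f 0, f j) \<in> parcs G ^^ Suc q" by auto
    with farj have "\<not> Suc q < m" by blast
    with q(1) have "Suc q = m" by simp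
    with step show ?thesis by simp
  qed
  with farj jk show ?thesis
    using mem_dist_sphere_iff[OF G assms(2)] by blast
qed

section \<open>Finite balls and masked configurations\<close>

lemma finite_relpow_Image:
  assumes G: "pair_wf_digraph G" and reg: "regular_digraph G d" and r: "r \<in> pverts G"
  shows "finite ((parcs G ^^ q) `` {r})" "(parcs G ^^ q) `` {r} \<subseteq> pverts G"
proof -
  interpret pair_wf_digraph G by fact
  have "finite ((parcs G ^^ q) `` {r}) \<and> (parcs G ^^ q) `` {r} \<subseteq> pverts G"
  proof (induction q)
    case (Suc q)
    have "(parcs G ^^ Suc q) `` {r} = (\<Union>u\<in>(parcs G ^^ q) `` {r}. out_nbrs G u)"
      by (auto simp: out_nbrs_def)
    moreover have "out_nbrs G u \<subseteq> pverts G" for u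
      by (auto simp: out_nbrs_def dest: in_arcsD2)
    ultimately show ?case
      using Suc reg by (auto simp: regular_digraph_def)
  qed (use r in auto)
  then show "finite ((parcs G ^^ q) `` {r})" "(parcs G ^^ q) `` {r} \<subseteq> pverts G" by auto
qed

lemma finite_dist_sphere:
  assumes "pair_wf_digraph G" "regular_digraph G d" "r \<in> pverts G"
  shows "finite (dist_sphere G r n)"
  by (rule finite_subset[OF _ finite_relpow_Image(1)[OF assms, of n]])
    (use mem_dist_sphere_iff[OF assms(1,3)] in auto)

text \<open>Emptying the states outside \<open>K\<close> expresses "using the states in
  \<open>K\<close> only": a connection in the masked configuration is determined by these states,
  and it persists in every configuration that agrees on \<open>K\<close>.\<close>

definition mask_config :: "'a pair_pre_digraph \<Rightarrow> 'a set \<Rightarrow> ('a \<Rightarrow> 'a set) \<Rightarrow> 'a \<Rightarrow> 'a set" where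
  "mask_config G K \<omega> = (\<lambda>v\<in>pverts G. if v \<in> K then \<omega> v else {})"

lemma mask_config_cong: "(\<forall>v\<in>K. \<eta> v = \<omega> v) \<Longrightarrow> mask_config G K \<eta> = mask_config G K \<omega>"
  by (auto simp: mask_config_def fun_eq_iff)

lemma mask_config_measurable:
  "mask_config G K \<in> measurable (config_measure G d p) (config_measure G d p)"
  unfolding mask_config_def config_measure_def
proof (rule measurable_restrict)
  fix v assume v: "v \<in> pverts G"
  show "(\<lambda>\<omega>. if v \<in> K then \<omega> v else {}) \<in>
      measurable (PiM (pverts G) (state_law G d p)) (state_law G d p v)"
    using measurable_component_singleton[OF v, of "state_law G d p"]
    by (cases "v \<in> K") (auto simp: state_law_def space_point_measure)
qed

lemma strong_rel_mask_config: "strong_rel G (mask_config G K \<omega>) \<subseteq> strong_rel G \<omega>"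
  unfolding strong_rel_def
  by (rule rtrancl_mono) (auto simp: open_arcs_def mask_config_def split: if_splits)

lemma strong_rel_path:
  assumes "\<And>i. a \<le> i \<Longrightarrow> i < b \<Longrightarrow> (f i, f (Suc i)) \<in> open_arcs G \<omega> \<and> (f (Suc i), f i) \<in> open_arcs G \<omega>"
    and "\<And>i. a \<le> i \<Longrightarrow> i \<le> b \<Longrightarrow> f i \<in> K" and "a \<le> b"
  shows "(f a, f b) \<in> strong_rel G (mask_config G K \<omega>)"
  using assms(3,1,2)
proof (induction b rule: dec_induct)
  case base
  then show ?case by (simp add: strong_rel_def)
next
  case (step b)
  have "(f a, f b) \<in> strong_rel G (mask_config G K \<omega>)" by (rule step.IH) (use step in auto)
  moreover have "(f b, f (Suc b)) \<in> {(x, y). (x, y) \<in> open_arcs G (mask_config G K \<omega>) \<and>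
      (y, x) \<in> open_arcs G (mask_config G K \<omega>)}"
    using step.prems(1)[of b] step.prems(2)[of b] step.prems(2)[of "Suc b"] step.hyps
    by (auto simp: open_arcs_def mask_config_def)
  ultimately show ?case unfolding strong_rel_def by (rule rtrancl_into_rtrancl)
qed

text \<open>A shortest open path to the sphere is self-avoiding, so its pieces before and after a
  visit to radius \<open>n\<close> use disjoint vertex sets. It also stays in the finite ball
  \<open>J\<close>, which makes the Reimer inequality applicable.\<close>

lemma reaches_sphere_split:
  assumes G: "pair_wf_digraph G" and r: "r \<in> pverts G" and reg: "regular_digraph G d"
    and \<omega>: "\<omega> \<in> reaches_sphere G d p r N"
    and N: "N = n + Suc m"
  defines "J \<equiv> \<Union>q\<le>N. (parcs G ^^ q) `` {r}"
  shows "\<exists>x\<in>dist_sphere G r n. \<exists>y\<in>out_nbrs G x. \<exists>K\<subseteq>J.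
    (r, x) \<in> strong_rel G (mask_config G K \<omega>) \<and>
    mask_config G (J - K) \<omega> \<in> reaches_sphere G d p y m"
proof -
  interpret pair_wf_digraph G by fact
  let ?M = "config_measure G d p"
  let ?R = "{(x, y). (x, y) \<in> open_arcs G \<omega> \<and> (y, x) \<in> open_arcs G \<omega>}"
  note sphere = mem_dist_sphere_iff[OF G]
  have sp: "\<omega> \<in> space ?M" using \<omega> by (simp add: reaches_sphere_def)
  have RE: "?R \<subseteq> parcs G"
    using sp by (auto simp: open_arcs_def space_config_measure out_nbrs_def PiE_iff)
  let ?hit = "\<lambda>k. \<exists>z\<in>dist_sphere G r N. (r, z) \<in> ?R ^^ k"
  have "\<exists>k. ?hit k"
    using \<omega> by (auto simp: reaches_sphere_def strong_rel_def rtrancl_power)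
  \<comment> \<open>The length is minimized over all endpoints on the sphere, so the path has no
    repetition and meets the sphere only at its end.\<close>
  define k where "k = (LEAST k. ?hit k)"
  have "?hit k" unfolding k_def using \<open>\<exists>k. ?hit k\<close> by (rule LeastI_ex)
  then obtain z where z: "z \<in> dist_sphere G r N" "(r, z) \<in> ?R ^^ k" by blast
  have minimal: "k \<le> i" if "z' \<in> dist_sphere G r N" "(r, z') \<in> ?R ^^ i" for z' i
    unfolding k_def using that by (blast intro: Least_le)
  obtain f where f: "f 0 = r" "f k = z" "\<And>i. i < k \<Longrightarrow> (f i, f (Suc i)) \<in> ?R"
    using z(2) unfolding relpow_fun_conv by blast
  have arc: "(f i, f (Suc i)) \<in> parcs G" if "i < k" for i using f(3)[OF that] RE by blast
  have seg: "(f i, f (i + l)) \<in> ?R ^^ l" if "i + l \<le> k" for i l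
    unfolding relpow_fun_conv using that f(3) by (intro exI[of _ "\<lambda>t. f (i + t)"]) auto
  have inj: "f i \<noteq> f j" if "i < j" "j \<le> k" for i j
  proof
    assume "f i = f j"
    then have "(r, f i) \<in> ?R ^^ i" "(f i, z) \<in> ?R ^^ (k - j)"
      using seg[of 0 i] seg[of j "k - j"] that f(1,2) by auto
    then have "(r, z) \<in> ?R ^^ (i + (k - j))" unfolding relpow_add by blast
    from minimal[OF z(1) this] that show False by simp
  qed
  \<comment> \<open>A vertex before the end at distance \<open>N\<close> or more would force an
    earlier visit to the sphere, against minimality of \<open>k\<close>.\<close>
  have inJ: "f i \<in> J" if "i \<le> k" for i
  proof (cases "i = k")
    case True
    have "(r, z) \<in> parcs G ^^ N" using z(1) unfolding sphere[OF r] by blast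
    then show ?thesis using True f(2) unfolding J_def by blast
  next
    case False
    have "\<exists>q<N. (f 0, f i) \<in> parcs G ^^ q"
    proof (rule ccontr)
      assume near: "\<not> ?thesis"
      have "\<exists>j\<le>i. f j \<in> dist_sphere G (f 0) N"
        by (rule path_meets_dist_sphere[OF G]) (use r f(1) arc that near in auto)
      then obtain j where j: "j \<le> i" "f j \<in> dist_sphere G (f 0) N" by blast
      then have "k \<le> j" using minimal[of "f j" j] seg[of 0 j] that f(1) by simp
      with j(1) that False show False by simp
    qed
    then obtain q where "q < N" "(f 0, f i) \<in> parcs G ^^ q" by blast
    then have "q \<in> {..N}" "f i \<in> (parcs G ^^ q) `` {r}" using f(1) by auto
    then show ?thesis unfolding J_def by blast
  qed
  have farN: "(r, z) \<notin> parcs G ^^ q" if "q < N" for q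
    using z(1) that unfolding sphere[OF r] by blast
  have "\<exists>j\<le>k. f j \<in> dist_sphere G (f 0) n"
    by (rule path_meets_dist_sphere[OF G]) (use r f(1,2) arc farN N in auto)
  then obtain j where j: "j \<le> k" "f j \<in> dist_sphere G r n" using f(1) by blast
  have rj: "(r, f j) \<in> parcs G ^^ n" using j(2) unfolding sphere[OF r] by blast
  have "j \<noteq> k" using rj farN[of n] f(2) N by auto
  with j(1) have jk: "j < k" by simp
  \<comment> \<open>The state at \<open>f j\<close> belongs to the first piece, so the second piece
    starts one arc later; this accounts for \<open>Suc m\<close> in
    \<open>N = n + Suc m\<close>.\<close>
  let ?y = "f (Suc j)" and ?K = "f ` {..j}"
  have y: "?y \<in> out_nbrs G (f j)" using arc[OF jk] by (simp add: out_nbrs_def)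
  have yV: "?y \<in> pverts G" using arc[OF jk] by (blast dest: in_arcsD2)
  have "(?y, z) \<notin> parcs G ^^ q" if "q < m" for q
  proof
    assume "(?y, z) \<in> parcs G ^^ q"
    moreover have "(r, ?y) \<in> parcs G ^^ Suc n" using rj arc[OF jk] by auto
    ultimately have "(r, z) \<in> parcs G ^^ (Suc n + q)" unfolding relpow_add by blast
    with farN[of "Suc n + q"] that N show False by simp
  qed
  \<comment> \<open>The end \<open>z\<close> is at distance at least \<open>m\<close> from
    \<open>?y\<close>, so the rest of the path meets the sphere of radius \<open>m\<close> around
    \<open>?y\<close>.\<close>
  then have "\<exists>l\<le>k - Suc j. f (Suc j + l) \<in> dist_sphere G (f (Suc j + 0)) m"
    by (intro path_meets_dist_sphere[OF G, where f = "\<lambda>t. f (Suc j + t)"])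
      (use yV f(2) arc jk in auto)
  then obtain l where l: "l \<le> k - Suc j" "f (Suc j + l) \<in> dist_sphere G ?y m" by auto
  have disj: "f i \<in> J - ?K" if "Suc j \<le> i" "i \<le> k" for i
  proof -
    have "f i \<notin> ?K"
    proof
      assume "f i \<in> ?K"
      then obtain i' where "i' \<le> j" "f i = f i'" by auto
      with inj[of i' i] that show False by simp
    qed
    with inJ[OF that(2)] show ?thesis by simp
  qed
  have "(f 0, f j) \<in> strong_rel G (mask_config G ?K \<omega>)"
  proof (rule strong_rel_path)
    show "(f i, f (Suc i)) \<in> open_arcs G \<omega> \<and> (f (Suc i), f i) \<in> open_arcs G \<omega>" if "i < j" for i
      using f(3)[of i] that jk by simp
  qed auto
  moreover have "(?y, f (Suc j + l)) \<in> strong_rel G (mask_config G (J - ?K) \<omega>)"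
  proof (rule strong_rel_path)
    show "(f i, f (Suc i)) \<in> open_arcs G \<omega> \<and> (f (Suc i), f i) \<in> open_arcs G \<omega>"
      if "i < Suc j + l" for i
      using f(3)[of i] that l(1) jk by simp
    show "f i \<in> J - ?K" if "Suc j \<le> i" "i \<le> Suc j + l" for i
      using disj[OF that(1)] that(2) l(1) jk by linarith
  qed simp
  moreover have "mask_config G (J - ?K) \<omega> \<in> space ?M"
    using measurable_space[OF mask_config_measurable sp] .
  ultimately have "(r, f j) \<in> strong_rel G (mask_config G ?K \<omega>)"
    "mask_config G (J - ?K) \<omega> \<in> reaches_sphere G d p ?y m"
    using l(2) f(1) unfolding reaches_sphere_def by blast+
  moreover have "?K \<subseteq> J" using inJ jk by auto
  ultimately show ?thesis using j(2) y by blast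
qed

section \<open>Recursive bound for the probability of reaching a sphere\<close>

abbreviation connects :: "'a pair_pre_digraph \<Rightarrow> nat \<Rightarrow> (nat \<Rightarrow> real) \<Rightarrow> 'a \<Rightarrow> 'a \<Rightarrow> ('a \<Rightarrow> 'a set) set" where
  "connects G d p r x \<equiv> {\<omega> \<in> space (config_measure G d p). (r, x) \<in> strong_rel G \<omega>}"

text \<open>A union bound over the splitting arc \<open>(x, y)\<close>, followed by the Reimer
  inequality for each arc.\<close>

lemma reaches_sphere_recursion:
  assumes G: "pair_wf_digraph G" and V: "countable (pverts G)" and r: "r \<in> pverts G"
    and reg: "regular_digraph G d"
    and p: "\<And>i. i \<le> d \<Longrightarrow> 0 \<le> p i" "(\<Sum>i\<le>d. p i) = 1"
  defines "M \<equiv> config_measure G d p"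
  shows "measure M (reaches_sphere G d p r (n + Suc m)) \<le>
    (\<Sum>x\<in>dist_sphere G r n. \<Sum>y\<in>out_nbrs G x.
      measure M (connects G d p r x) * measure M (reaches_sphere G d p y m))"
proof -
  interpret M: prob_space M
    unfolding M_def by (rule prob_space_config_measure[OF reg p])
  define J where "J = (\<Union>q\<le>n + Suc m. (parcs G ^^ q) `` {r})"
  have J: "finite J" "J \<subseteq> pverts G"
    unfolding J_def using finite_relpow_Image[OF G reg r] by auto
  \<comment> \<open>Disjoint occurrence of the two connections. The witness set \<open>K\<close>
    depends on the configuration, but only finitely many subsets of \<open>J\<close> compete, so
    \<open>W x y\<close> is measurable.\<close>
  define W where "W = (\<lambda>x y. \<Union>K\<in>Pow J.
    (mask_config G K -` connects G d p r x \<inter> space M) \<inter>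
    (mask_config G (J - K) -` reaches_sphere G d p y m \<inter> space M))"
  have mask: "mask_config G K \<in> measurable M M" for K
    unfolding M_def by (rule mask_config_measurable)
  have conn: "connects G d p r x \<in> sets M" for x
    unfolding M_def using V by (rule measurable_strong_rel)
  have reach: "reaches_sphere G d p y k \<in> sets M" for y k
    unfolding M_def using V by (rule reaches_sphere_sets)
  have Wsets: "W x y \<in> sets M" for x y
    unfolding W_def using J(1) measurable_sets[OF mask conn] measurable_sets[OF mask reach]
    by (intro sets.finite_UN) auto
  have S: "finite (dist_sphere G r n)" by (rule finite_dist_sphere[OF G reg r])
  have L: "finite (out_nbrs G x)" if "x \<in> dist_sphere G r n" for x
    using that reg by (auto simp: regular_digraph_def dist_sphere_def)
  have "reaches_sphere G d p r (n + Suc m) \<subseteq> (\<Union>x\<in>dist_sphere G r n. \<Union>y\<in>out_nbrs G x. W x y)"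
  proof
    fix \<omega> assume \<omega>: "\<omega> \<in> reaches_sphere G d p r (n + Suc m)"
    then have sp: "\<omega> \<in> space M" by (simp add: M_def reaches_sphere_def)
    obtain x y K where xy: "x \<in> dist_sphere G r n" "y \<in> out_nbrs G x"
      and K: "K \<subseteq> J" "(r, x) \<in> strong_rel G (mask_config G K \<omega>)"
        "mask_config G (J - K) \<omega> \<in> reaches_sphere G d p y m"
      using reaches_sphere_split[OF G r reg \<omega> refl, folded J_def] by blast
    have "mask_config G K \<omega> \<in> connects G d p r x"
      using K(2) measurable_space[OF mask sp] by (simp add: M_def)
    with K(1,3) sp have "\<omega> \<in> W x y" unfolding W_def by blast
    with xy show "\<omega> \<in> (\<Union>x\<in>dist_sphere G r n. \<Union>y\<in>out_nbrs G x. W x y)" by blast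
  qed
  then have "measure M (reaches_sphere G d p r (n + Suc m)) \<le>
      measure M (\<Union>x\<in>dist_sphere G r n. \<Union>y\<in>out_nbrs G x. W x y)"
    using S L Wsets by (intro M.finite_measure_mono sets.finite_UN) auto
  also have "\<dots> \<le> (\<Sum>x\<in>dist_sphere G r n. measure M (\<Union>y\<in>out_nbrs G x. W x y))"
    using S L Wsets by (intro M.finite_measure_subadditive_finite) (auto intro!: sets.finite_UN)
  also have "\<dots> \<le> (\<Sum>x\<in>dist_sphere G r n. \<Sum>y\<in>out_nbrs G x. measure M (W x y))"
    using L Wsets by (intro sum_mono M.finite_measure_subadditive_finite) auto
  also have "\<dots> \<le> (\<Sum>x\<in>dist_sphere G r n. \<Sum>y\<in>out_nbrs G x.
      measure M (connects G d p r x) * measure M (reaches_sphere G d p y m))"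
  proof (intro sum_mono)
    fix x y
    show "measure M (W x y) \<le> measure M (connects G d p r x) * measure M (reaches_sphere G d p y m)"
      unfolding M_def config_measure_def
    proof (rule van_den_Berg_Kesten_Reimer[where J = J])
      show "prob_space (state_law G d p v)" if "v \<in> pverts G" for v
        using prob_space_state_law[OF reg that p] .
      show "pverts G \<noteq> {}" using r by blast
      show "finite J" "J \<subseteq> pverts G" by fact+
      show "W x y \<in> sets (PiM (pverts G) (state_law G d p))"
        "{\<omega> \<in> space (PiM (pverts G) (state_law G d p)). (r, x) \<in> strong_rel G \<omega>} \<in>
          sets (PiM (pverts G) (state_law G d p))"
        "reaches_sphere G d p y m \<in> sets (PiM (pverts G) (state_law G d p))"
        using Wsets[of x y] conn[of x] reach[of y m] unfolding M_def config_measure_def .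
    next
      fix \<omega> assume "\<omega> \<in> W x y"
      then obtain K where K: "(r, x) \<in> strong_rel G (mask_config G K \<omega>)"
        "mask_config G (J - K) \<omega> \<in> reaches_sphere G d p y m"
        unfolding W_def by blast
      show "\<exists>K. (\<forall>\<eta>\<in>space (PiM (pverts G) (state_law G d p)). (\<forall>i\<in>K. \<eta> i = \<omega> i) \<longrightarrow>
            \<eta> \<in> {\<omega> \<in> space (PiM (pverts G) (state_law G d p)). (r, x) \<in> strong_rel G \<omega>}) \<and>
          (\<forall>\<eta>\<in>space (PiM (pverts G) (state_law G d p)). (\<forall>i\<in>J - K. \<eta> i = \<omega> i) \<longrightarrow>
            \<eta> \<in> reaches_sphere G d p y m)"
      proof (intro exI[of _ K] conjI ballI impI)
        fix \<eta> assume \<eta>: "\<eta> \<in> space (PiM (pverts G) (state_law G d p))" "\<forall>i\<in>K. \<eta> i = \<omega> i"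
        \<comment> \<open>Configurations that agree on \<open>K\<close> have the same mask, and
          removing the mask only adds open arcs.\<close>
        from K(1) have "(r, x) \<in> strong_rel G \<eta>"
          unfolding mask_config_cong[OF \<eta>(2), symmetric] using strong_rel_mask_config by blast
        with \<eta>(1) show "\<eta> \<in> {\<omega> \<in> space (PiM (pverts G) (state_law G d p)). (r, x) \<in> strong_rel G \<omega>}"
          by blast
      next
        fix \<eta> assume \<eta>: "\<eta> \<in> space (PiM (pverts G) (state_law G d p))" "\<forall>i\<in>J - K. \<eta> i = \<omega> i"
        from K(2) have "mask_config G (J - K) \<eta> \<in> reaches_sphere G d p y m"
          unfolding mask_config_cong[OF \<eta>(2)] .
        with \<eta>(1) show "\<eta> \<in> reaches_sphere G d p y m"
          using strong_rel_mask_config[of G "J - K" \<eta>]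
          unfolding reaches_sphere_def config_measure_def by blast
      qed
    qed
  qed
  finally show ?thesis .
qed

section \<open>Invariance under automorphisms\<close>

text \<open>Transport of a configuration along \<open>h\<close>: the state at \<open>h u\<close> is
  the image of the state at \<open>u\<close>, so \<open>h\<close> maps open arcs to open
  arcs.\<close>

definition push_config :: "'a pair_pre_digraph \<Rightarrow> ('a \<Rightarrow> 'a) \<Rightarrow> ('a \<Rightarrow> 'a set) \<Rightarrow> 'a \<Rightarrow> 'a set" where
  "push_config G h \<omega> = (\<lambda>v\<in>pverts G. h ` \<omega> (inv_into (pverts G) h v))"

locale digraph_automorphism = pair_wf_digraph G for G :: "'a pair_pre_digraph" +
  fixes h :: "'a \<Rightarrow> 'a"
  assumes bij: "bij_betw h (pverts G) (pverts G)"
    and arc: "\<And>u v. u \<in> pverts G \<Longrightarrow> v \<in> pverts G \<Longrightarrow> (u, v) \<in> parcs G \<longleftrightarrow> (h u, h v) \<in> parcs G"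
begin

abbreviation g where "g \<equiv> inv_into (pverts G) h"

lemma g_in [simp]: "v \<in> pverts G \<Longrightarrow> g v \<in> pverts G"
  using bij by (metis bij_betw_def inv_into_into)

lemma h_in [simp]: "v \<in> pverts G \<Longrightarrow> h v \<in> pverts G"
  using bij by (auto simp: bij_betw_def)

lemma hg [simp]: "v \<in> pverts G \<Longrightarrow> h (g v) = v"
  using bij by (auto simp: bij_betw_def intro: f_inv_into_f)

lemma gh [simp]: "v \<in> pverts G \<Longrightarrow> g (h v) = v"
  using bij by (auto simp: bij_betw_def)

lemma inj_h: "inj_on h (pverts G)"
  using bij by (simp add: bij_betw_def)

lemma out_nbrs_sub: "out_nbrs G u \<subseteq> pverts G"
  by (auto simp: out_nbrs_def dest: in_arcsD2)

lemma image_out_nbrs: "u \<in> pverts G \<Longrightarrow> h ` out_nbrs G u = out_nbrs G (h u)"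
proof (intro equalityI subsetI)
  fix y assume u: "u \<in> pverts G" and y: "y \<in> out_nbrs G (h u)"
  then have yV: "y \<in> pverts G" using out_nbrs_sub by blast
  with y u arc[of u "g y"] have "g y \<in> out_nbrs G u" by (simp add: out_nbrs_def)
  then show "y \<in> h ` out_nbrs G u" using yV by (metis hg imageI)
qed (use arc in \<open>auto simp: out_nbrs_def dest: in_arcsD2\<close>)

lemma relpow_image:
  assumes "u \<in> pverts G" "v \<in> pverts G"
  shows "(u, v) \<in> parcs G ^^ n \<longleftrightarrow> (h u, h v) \<in> parcs G ^^ n"
  using assms
proof (induction n arbitrary: v)
  case 0
  then show ?case using inj_h by (auto dest: inj_onD)
next
  case (Suc n)
  have "(u, v) \<in> parcs G ^^ Suc n \<longleftrightarrow> (\<exists>w\<in>pverts G. (u, w) \<in> parcs G ^^ n \<and> (w, v) \<in> parcs G)"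
    by (auto dest: in_arcsD1)
  also have "\<dots> \<longleftrightarrow> (\<exists>w\<in>pverts G. (h u, h w) \<in> parcs G ^^ n \<and> (h w, h v) \<in> parcs G)"
    using Suc arc by blast
  also have "\<dots> \<longleftrightarrow> (\<exists>w\<in>h ` pverts G. (h u, w) \<in> parcs G ^^ n \<and> (w, h v) \<in> parcs G)"
    by blast
  also have "\<dots> \<longleftrightarrow> (h u, h v) \<in> parcs G ^^ Suc n"
    using bij by (auto simp: bij_betw_def dest: in_arcsD1)
  finally show ?case .
qed

lemma dist_sphere_image:
  assumes "u \<in> pverts G" "v \<in> dist_sphere G u n"
  shows "h v \<in> dist_sphere G (h u) n"
proof -
  have v: "v \<in> pverts G" using assms(2) by (simp add: dist_sphere_def)
  have wf: "pair_wf_digraph G" by unfold_locales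
  show ?thesis
    using assms(2) relpow_image[OF assms(1) v]
    unfolding mem_dist_sphere_iff[OF wf assms(1)] mem_dist_sphere_iff[OF wf h_in[OF assms(1)]]
    by blast
qed

text \<open>The weight of a state depends only on its cardinality, and \<open>h\<close> maps the
  neighbourhood of \<open>u\<close> bijectively onto that of \<open>h u\<close>.\<close>

lemma emeasure_state_law_vimage:
  assumes reg: "regular_digraph G d" and u: "u \<in> pverts G" and F: "F \<subseteq> Pow (out_nbrs G (h u))"
  shows "emeasure (state_law G d p u) {S \<in> Pow (out_nbrs G u). h ` S \<in> F} =
    emeasure (state_law G d p (h u)) F"
proof -
  let ?E = "{S \<in> Pow (out_nbrs G u). h ` S \<in> F}"
  have fin: "finite (out_nbrs G v)" if "v \<in> pverts G" for v
    using reg that by (simp add: regular_digraph_def)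
  have inj: "inj_on h (out_nbrs G u)" using inj_h out_nbrs_sub by (rule inj_on_subset)
  have "F \<subseteq> (`) h ` ?E"
  proof
    fix S assume S: "S \<in> F"
    then have "S \<subseteq> h ` out_nbrs G u" using F image_out_nbrs[OF u] by blast
    then obtain S' where "S' \<subseteq> out_nbrs G u" "S = h ` S'" by (auto simp: subset_image_iff)
    with S show "S \<in> (`) h ` ?E" by blast
  qed
  moreover have "inj_on ((`) h) ?E"
    using inj_on_image_Pow[OF inj] by (rule inj_on_subset) auto
  ultimately have bij': "bij_betw ((`) h) ?E F"
    by (auto simp: bij_betw_def)
  have card: "card (h ` S) = card S" if "S \<in> ?E" for S
    using that inj by (intro card_image) (auto intro: inj_on_subset)
  have "emeasure (state_law G d p (h u)) F =
      (\<Sum>S\<in>F. ennreal (p (card S) / real (d choose card S)))"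
    unfolding state_law_def using F fin[of "h u"] u by (subst emeasure_point_measure_finite) auto
  also have "\<dots> = (\<Sum>S\<in>?E. ennreal (p (card S) / real (d choose card S)))"
    unfolding sum.reindex_bij_betw[OF bij', symmetric] using card by (intro sum.cong) auto
  also have "\<dots> = emeasure (state_law G d p u) ?E"
    unfolding state_law_def using fin[of u] u by (subst emeasure_point_measure_finite) auto
  finally show ?thesis by simp
qed

lemma push_config_measurable:
  "push_config G h \<in> measurable (config_measure G d p) (config_measure G d p)"
  unfolding push_config_def config_measure_def
proof (rule measurable_restrict)
  fix v assume v: "v \<in> pverts G"
  have "(`) h \<in> measurable (state_law G d p (g v)) (state_law G d p v)"
    unfolding state_law_def using image_out_nbrs[of "g v"] v
    by (auto simp: measurable_point_measure_eq1 space_point_measure)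
  with measurable_component_singleton[OF g_in[OF v], of "state_law G d p"]
  show "(\<lambda>\<omega>. h ` \<omega> (g v)) \<in> measurable (PiM (pverts G) (state_law G d p)) (state_law G d p v)"
    by (rule measurable_compose)
qed

lemma distr_push_config:
  assumes reg: "regular_digraph G d"
    and p: "\<And>i. i \<le> d \<Longrightarrow> 0 \<le> p i" "(\<Sum>i\<le>d. p i) = 1"
  defines "M \<equiv> config_measure G d p"
  shows "distr M M (push_config G h) = M"
proof -
  have st: "prob_space (state_law G d p v)" if "v \<in> pverts G" for v
    using prob_space_state_law[OF reg that p] .
  have meas: "push_config G h \<in> measurable M M"
    unfolding M_def by (rule push_config_measurable)
  have "M = distr M M (push_config G h)"
    unfolding config_measure_def[of G d p, folded M_def]
  proof (rule measure_eqI_PiM_infinite)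
    let ?P = "PiM (pverts G) (state_law G d p)"
    have PM: "?P = M" by (simp add: M_def config_measure_def)
    fix F J assume J: "finite J" "J \<subseteq> pverts G" and F: "\<And>v. v \<in> J \<Longrightarrow> F v \<in> sets (state_law G d p v)"
    have FP: "F v \<subseteq> Pow (out_nbrs G v)" if "v \<in> J" for v
      using F[OF that] by (simp add: state_law_def sets_point_measure)
    have inj: "inj_on g J" using J(2) by (intro inj_on_inverseI[of _ h]) auto
    let ?H = "\<lambda>u. {S \<in> Pow (out_nbrs G u). h ` S \<in> F (h u)}"
    have "emeasure ?P (prod_emb (pverts G) (state_law G d p) J (Pi\<^sub>E J F)) =
        (\<Prod>v\<in>J. emeasure (state_law G d p v) (F v))"
      by (rule emeasure_PiM_emb[OF st J(2,1) F])
    also have "\<dots> = (\<Prod>v\<in>J. emeasure (state_law G d p (g v)) (?H (g v)))"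
    proof (rule prod.cong)
      fix v assume v: "v \<in> J"
      then have "v \<in> pverts G" using J(2) by blast
      then show "emeasure (state_law G d p v) (F v) = emeasure (state_law G d p (g v)) (?H (g v))"
        using emeasure_state_law_vimage[OF reg, of "g v" "F v" p] FP[OF v] by simp
    qed simp
    also have "\<dots> = (\<Prod>u\<in>g ` J. emeasure (state_law G d p u) (?H u))"
      by (simp add: prod.reindex[OF inj])
    also have "\<dots> = emeasure ?P (prod_emb (pverts G) (state_law G d p) (g ` J) (Pi\<^sub>E (g ` J) ?H))"
      using J by (intro emeasure_PiM_emb[OF st, symmetric])
        (auto simp: state_law_def sets_point_measure)
    also have "prod_emb (pverts G) (state_law G d p) (g ` J) (Pi\<^sub>E (g ` J) ?H) =
        push_config G h -` prod_emb (pverts G) (state_law G d p) J (Pi\<^sub>E J F) \<inter> space ?P"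
    proof (rule set_eqI)
      fix \<omega>
      have hgJ: "h (g v) = v" "v \<in> pverts G" "g v \<in> pverts G" if "v \<in> J" for v using that J(2) by auto
      have "push_config G h \<omega> \<in> space ?P" if "\<omega> \<in> space ?P"
        using measurable_space[OF meas] that unfolding PM by blast
      moreover have "x \<in> out_nbrs G v" if "\<omega> \<in> space ?P" "v \<in> pverts G" "x \<in> \<omega> v" for v x
        using that by (auto simp: space_PiM PiE_iff state_law_def space_point_measure)
      ultimately show "\<omega> \<in> prod_emb (pverts G) (state_law G d p) (g ` J) (Pi\<^sub>E (g ` J) ?H) \<longleftrightarrow>
          \<omega> \<in> push_config G h -` prod_emb (pverts G) (state_law G d p) J (Pi\<^sub>E J F) \<inter> space ?P"
        using hgJ by (auto simp: prod_emb_def PiE_iff push_config_def space_PiM)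
    qed
    also have "emeasure ?P \<dots> = emeasure (distr ?P ?P (push_config G h))
        (prod_emb (pverts G) (state_law G d p) J (Pi\<^sub>E J F))"
      using J F meas unfolding PM
      by (intro emeasure_distr[symmetric]) (auto simp flip: PM intro!: sets_PiM_I)
    finally show "emeasure ?P (prod_emb (pverts G) (state_law G d p) J (Pi\<^sub>E J F)) =
      emeasure (distr ?P ?P (push_config G h)) (prod_emb (pverts G) (state_law G d p) J (Pi\<^sub>E J F))" .
  next
    show "finite_measure (PiM (pverts G) (state_law G d p))"
    proof -
      interpret P: prob_space "PiM (pverts G) (state_law G d p)" by (rule prob_space_PiM[OF st])
      show ?thesis by (rule P.finite_measure_axioms)
    qed
  qed simp_all
  then show ?thesis by simp
qed

text \<open>Automorphisms preserve distances and strong connections, so \<open>push_config\<close>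
  carries the first event into the second while preserving the measure.\<close>

lemma measure_reaches_sphere_image:
  assumes V: "countable (pverts G)" and reg: "regular_digraph G d" and y: "y \<in> pverts G"
    and p: "\<And>i. i \<le> d \<Longrightarrow> 0 \<le> p i" "(\<Sum>i\<le>d. p i) = 1"
  shows "measure (config_measure G d p) (reaches_sphere G d p y m) \<le>
    measure (config_measure G d p) (reaches_sphere G d p (h y) m)"
proof -
  let ?M = "config_measure G d p"
  interpret M: prob_space ?M by (rule prob_space_config_measure[OF reg p])
  have meas: "push_config G h \<in> measurable ?M ?M" by (rule push_config_measurable)
  have sets: "reaches_sphere G d p (h y) m \<in> sets ?M" by (rule reaches_sphere_sets[OF V])
  have conn: "(h u, h v) \<in> strong_rel G (push_config G h \<omega>)"
    if "(u, v) \<in> strong_rel G \<omega>" for u v \<omega>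
    using that unfolding strong_rel_def
  proof (induction rule: rtrancl_induct)
    case (step v w)
    then have "(h v, h w) \<in> {(x, y). (x, y) \<in> open_arcs G (push_config G h \<omega>) \<and>
        (y, x) \<in> open_arcs G (push_config G h \<omega>)}"
      by (auto simp: open_arcs_def push_config_def)
    with step.IH show ?case by (rule rtrancl_into_rtrancl)
  qed simp
  have "reaches_sphere G d p y m \<subseteq> push_config G h -` reaches_sphere G d p (h y) m \<inter> space ?M"
  proof
    fix \<omega> assume \<omega>: "\<omega> \<in> reaches_sphere G d p y m"
    then obtain z where z: "z \<in> dist_sphere G y m" "(y, z) \<in> strong_rel G \<omega>" "\<omega> \<in> space ?M"
      by (auto simp: reaches_sphere_def)
    from measurable_space[OF meas z(3)] dist_sphere_image[OF y z(1)] conn[OF z(2)] z(3)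
    show "\<omega> \<in> push_config G h -` reaches_sphere G d p (h y) m \<inter> space ?M"
      by (auto simp: reaches_sphere_def)
  qed
  then have "measure ?M (reaches_sphere G d p y m) \<le>
      measure ?M (push_config G h -` reaches_sphere G d p (h y) m \<inter> space ?M)"
    by (intro M.finite_measure_mono measurable_sets[OF meas sets])
  also have "\<dots> = measure (distr ?M ?M (push_config G h)) (reaches_sphere G d p (h y) m)"
    by (rule measure_distr[OF meas sets, symmetric])
  finally show ?thesis by (simp add: distr_push_config[OF reg p])
qed

end

section \<open>Exponential decay\<close>

text \<open>By linearity the sum is the expected number of cluster vertices in
  \<open>F\<close>.\<close>

lemma sum_connects_le_susceptibility:
  assumes V: "countable (pverts G)" and F: "finite F" "F \<subseteq> pverts G"
    and reg: "regular_digraph G d"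
    and p: "\<And>i. i \<le> d \<Longrightarrow> 0 \<le> p i" "(\<Sum>i\<le>d. p i) = 1"
  shows "ennreal (\<Sum>x\<in>F. measure (config_measure G d p) (connects G d p r x)) \<le>
    strong_susceptibility G d p r"
proof -
  let ?M = "config_measure G d p"
  interpret M: prob_space ?M by (rule prob_space_config_measure[OF reg p])
  have conn: "connects G d p r x \<in> sets ?M" for x by (rule measurable_strong_rel[OF V])
  have "ennreal (\<Sum>x\<in>F. measure ?M (connects G d p r x)) =
      (\<Sum>x\<in>F. emeasure ?M (connects G d p r x))"
    by (simp add: M.emeasure_eq_measure sum_ennreal)
  also have "\<dots> = (\<integral>\<^sup>+ \<omega>. (\<Sum>x\<in>F. indicator (connects G d p r x) \<omega>) \<partial>?M)"
    using conn by (subst nn_integral_sum) auto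
  also have "\<dots> \<le> strong_susceptibility G d p r"
    unfolding strong_susceptibility_def
  proof (rule nn_integral_mono)
    fix \<omega> assume \<omega>: "\<omega> \<in> space ?M"
    have "(\<Sum>x\<in>F. indicator (connects G d p r x) \<omega> :: ennreal) =
        of_nat (card (F \<inter> strong_cluster G \<omega> r))"
      using F \<omega> by (auto simp: indicator_def sum.If_cases strong_cluster_def intro!: arg_cong[where f = card])
    also have "\<dots> = emeasure (count_space (pverts G)) (F \<inter> strong_cluster G \<omega> r)"
      using F by (subst emeasure_count_space_finite) auto
    also have "\<dots> \<le> emeasure (count_space (pverts G)) (strong_cluster G \<omega> r)"
      by (rule emeasure_mono) (auto simp: strong_cluster_def)
    finally show "(\<Sum>x\<in>F. indicator (connects G d p r x) \<omega>) \<le>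
        emeasure (count_space (pverts G)) (strong_cluster G \<omega> r)" .
  qed
  finally show ?thesis .
qed

text \<open>Spheres of different radii are disjoint, so if every sphere sum exceeded \<epsilon>,
  enough of them together would exceed the finite susceptibility.\<close>

lemma exists_small_sphere_sum:
  assumes G: "pair_wf_digraph G" and V: "countable (pverts G)" and r: "r \<in> pverts G"
    and reg: "regular_digraph G d"
    and p: "\<And>i. i \<le> d \<Longrightarrow> 0 \<le> p i" "(\<Sum>i\<le>d. p i) = 1"
    and fin: "strong_susceptibility G d p r < \<infinity>" and "0 < \<epsilon>"
  shows "\<exists>n. (\<Sum>x\<in>dist_sphere G r n. measure (config_measure G d p) (connects G d p r x)) \<le> \<epsilon>"
proof (rule ccontr)
  let ?\<sigma> = "\<lambda>n. \<Sum>x\<in>dist_sphere G r n. measure (config_measure G d p) (connects G d p r x)"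
  assume "\<not> ?thesis"
  then have large: "\<epsilon> \<le> ?\<sigma> n" for n by (meson linear)
  obtain N :: nat where N: "enn2real (strong_susceptibility G d p r) < N * \<epsilon>"
    using reals_Archimedean3[OF \<open>0 < \<epsilon>\<close>] by blast
  let ?F = "\<Union>n<N. dist_sphere G r n"
  have "N * \<epsilon> \<le> (\<Sum>n<N. ?\<sigma> n)" using sum_bounded_below[of "{..<N}" \<epsilon> ?\<sigma>] large by simp
  also have "\<dots> = (\<Sum>x\<in>?F. measure (config_measure G d p) (connects G d p r x))"
    using finite_dist_sphere[OF G reg r]
    by (intro sum.UNION_disjoint[symmetric]) (auto simp: dist_sphere_def)
  also have "\<dots> \<le> enn2real (strong_susceptibility G d p r)"
  proof -
    have "ennreal (\<Sum>x\<in>?F. measure (config_measure G d p) (connects G d p r x)) \<le>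
        strong_susceptibility G d p r"
      using finite_dist_sphere[OF G reg r]
      by (intro sum_connects_le_susceptibility[OF V _ _ reg p]) (auto simp: dist_sphere_def)
    \<comment> \<open>Finiteness matters here: \<open>enn2real\<close> sends infinity to 0.\<close>
    from enn2real_mono[OF this] fin show ?thesis by (simp add: sum_nonneg)
  qed
  finally show False using N by simp
qed

text \<open>Each block of length \<open>L\<close> halves the bound, and the exponential loses
  exactly a factor 2 over such a block. The constant 2 pays for the incomplete block.\<close>

lemma geometric_decay:
  fixes \<theta> :: "nat \<Rightarrow> real"
  assumes "0 < L" and le1: "\<And>k. \<theta> k \<le> 1" and half: "\<And>m. \<theta> (L + m) \<le> \<theta> m / 2"
  shows "\<theta> k \<le> 2 * exp (- real k * (ln 2 / real L))"
proof (induction k rule: less_induct)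
  case (less k)
  show ?case
  proof (cases "k < L")
    case True
    then have "real k * (ln 2 / real L) \<le> real L * (ln 2 / real L)"
      by (intro mult_right_mono) auto
    then have "exp (- ln 2 :: real) \<le> exp (- real k * (ln 2 / real L))"
      using assms(1) by simp
    then show ?thesis using le1[of k] by (simp add: exp_minus)
  next
    case False
    then obtain m where k: "k = L + m" using le_Suc_ex by (metis not_less)
    have "\<theta> k \<le> \<theta> m / 2" using half k by simp
    also have "\<dots> \<le> exp (- real m * (ln 2 / real L))"
      using less.IH[of m] k assms(1) by simp
    also have "- real m * (ln 2 / real L) = ln 2 + - real k * (ln 2 / real L)"
      using assms(1) k by (simp add: field_simps)
    also have "exp \<dots> = 2 * exp (- real k * (ln 2 / real L))" by (simp only: exp_add) simp
    finally show ?thesis .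
  qed
qed

theorem theorem20:
  fixes G :: "'a pair_pre_digraph" and r :: 'a and d :: nat and p :: "nat \<Rightarrow> real"
  assumes "pair_bidirected_digraph G"
    and "countable (pverts G)" and "infinite (pverts G)"
    and "r \<in> pverts G"
    and "regular_digraph G d"
    and "Digraph_Component.connected (with_proj G)"
    and "vertex_transitive G"
    and "\<And>i. i \<le> d \<Longrightarrow> 0 \<le> p i" and "(\<Sum>i\<le>d. p i) = 1"
    and "strong_susceptibility G d p r < \<infinity>"
  shows "\<exists>\<alpha>>0. \<forall>\<^sub>F n in sequentially.
    measure (config_measure G d p) (reaches_sphere G d p r n) \<le> 2 * exp (- real n * \<alpha>)"
proof -
  interpret pair_bidirected_digraph G by fact
  have G: "pair_wf_digraph G" by unfold_locales
  let ?M = "config_measure G d p"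
  interpret M: prob_space ?M by (rule prob_space_config_measure[OF assms(5,8,9)])
  define \<theta> where "\<theta> = (\<lambda>n. measure ?M (reaches_sphere G d p r n))"
  \<comment> \<open>Apply invariance to an automorphism that takes \<open>y\<close> to
    \<open>r\<close>.\<close>
  have invariant: "measure ?M (reaches_sphere G d p y m) \<le> \<theta> m" if "y \<in> pverts G" for y m
  proof -
    from assms(7)[unfolded vertex_transitive_iff[OF G], rule_format, OF that assms(4)]
    obtain h where "bij_betw h (pverts G) (pverts G)" "h y = r"
      "\<forall>u\<in>pverts G. \<forall>v\<in>pverts G. (u, v) \<in> parcs G \<longleftrightarrow> (h u, h v) \<in> parcs G"
      by (elim exE conjE)
    then interpret digraph_automorphism G h by unfold_locales auto
    show ?thesis
      using measure_reaches_sphere_image[OF assms(2,5) that assms(8,9), of m] \<open>h y = r\<close>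
      by (simp add: \<theta>_def)
  qed
  \<comment> \<open>With \<open>d\<close> neighbours per vertex the recursion factor becomes
    \<open>d / (2 * (d + 1))\<close>, at most 1/2; \<open>d + 1\<close> keeps the denominator
    nonzero for \<open>d = 0\<close>.\<close>
  have "0 < 1 / (2 * (real d + 1))" by simp
  from exists_small_sphere_sum[OF G assms(2,4,5,8,9,10) this] obtain n where
    n: "(\<Sum>x\<in>dist_sphere G r n. measure ?M (connects G d p r x)) \<le> 1 / (2 * (real d + 1))" by blast
  have half: "\<theta> (Suc n + m) \<le> \<theta> m / 2" for m
  proof -
    have "\<theta> (Suc n + m) \<le> (\<Sum>x\<in>dist_sphere G r n. \<Sum>y\<in>out_nbrs G x.
        measure ?M (connects G d p r x) * measure ?M (reaches_sphere G d p y m))"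
      using reaches_sphere_recursion[OF G assms(2,4,5,8,9), of n m] by (simp add: \<theta>_def)
    also have "\<dots> \<le> (\<Sum>x\<in>dist_sphere G r n. \<Sum>y\<in>out_nbrs G x. measure ?M (connects G d p r x) * \<theta> m)"
      by (intro sum_mono mult_left_mono invariant) (auto simp: out_nbrs_def dest: in_arcsD2)
    also have "\<dots> = real d * \<theta> m * (\<Sum>x\<in>dist_sphere G r n. measure ?M (connects G d p r x))"
      unfolding sum_distrib_left using assms(5)
      by (intro sum.cong) (auto simp: regular_digraph_def dist_sphere_def)
    also have "\<dots> \<le> real d * \<theta> m * (1 / (2 * (real d + 1)))"
      by (intro mult_left_mono n) (simp add: \<theta>_def)
    also have "\<dots> = \<theta> m / 2 * (real d / (real d + 1))" by (simp add: field_simps)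
    also have "\<dots> \<le> \<theta> m / 2 * 1" by (intro mult_left_mono) (auto simp: \<theta>_def)
    finally show ?thesis by simp
  qed
  \<comment> \<open>The block length is \<open>Suc n\<close>: radius \<open>n\<close> plus the arc
    from \<open>x\<close> to \<open>y\<close>. The bound obtained holds for every
    \<open>k\<close>.\<close>
  have "\<theta> k \<le> 2 * exp (- real k * (ln 2 / real (Suc n)))" for k
    by (rule geometric_decay[where \<theta> = \<theta>, OF _ _ half]) (auto simp: \<theta>_def)
  then show ?thesis
    unfolding \<theta>_def by (intro exI[of _ "ln 2 / real (Suc n)"]) auto
qed

end
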